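(* There exist absolute constants $C>0$ and $d\ge 0$ such that for every finite set $A\subset\mathbb{R}$ with $|A|\ge 2$, $$|A-A|^6\,|A/A|^{13}\ \ge\ C\,\frac{|A|^{23}}{\log^{d}|A|}.$$ In particular, for every $K\ge1$ there exist constants $C_K>0$ and $d\ge0$ such that every finite $A\subset\mathbb{R}$ with $|A|\ge2$ and $|A/A|\le K|A|$ satisfies $|A-A|\ge C_K|A|^{5/3}\log^{-d}|A|$.
   Context: $A-A=\{a-a' : a,a'\in A\}$ and $A/A=\{a/b: a,b\in A,\ b\neq 0\}$. Logarithms are base 2. The paper writes the first bound as $|A-A|^6|A/A|^{13}\gtrsim|A|^{23}$, where $x\lesssim y$ means $x=O(y\log^c|A|)$ for some constant $c>0$. *)

theory Defs
  imports Complex_Main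
begin

text \<open>
  On sets, \<open>A - A\<close> is set-theoretic difference, so the set of differences needs its own name.
\<close>

definition difference_set :: "real set \<Rightarrow> real set" where
  "difference_set A = {a - a' | a a'. a \<in> A \<and> a' \<in> A}"

definition ratio_set :: "real set \<Rightarrow> real set" where
  "ratio_set A = {a / b | a b. a \<in> A \<and> b \<in> A \<and> b \<noteq> 0}"

end

theory Submission
  imports Defs "HOL-Analysis.Convex"
begin

text \<open>
  Write \<open>n = |A|\<close>, \<open>Q = A / A\<close>, \<open>D = A - A\<close>, with \<open>0 \<notin> A\<close>, and ignore logarithms. The Szemeredi--Trotter bound
  is only needed for points of a Cartesian product, where it is elementary: cut the product into \<open>r \<times> r\<close>
  cells; a monotone line meets \<open>O(r)\<close> of them, and two points in a cell determine the line.

  Call \<open>c \<in> Q\<close> a link between \<open>a, u \<in> A\<close> if \<open>a / c, u / c \<in> A\<close>. On average a pair has about \<open>k = n\<^sup>2 / |Q|\<close>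
  links; keep \<open>k\<close> of them for each of \<open>\<Omega>(n\<^sup>2)\<close> pairs, and pass to a dyadic class
  \<open>|A \<inter> cA| \<approx> \<Delta>\<close> of links. A configuration consists of \<open>a, u, b \<in> A\<close> with links \<open>c\<close> of \<open>(a, u)\<close> and \<open>d\<close> of
  \<open>(b, u)\<close>. With \<open>x = a - u\<close> and \<open>y = b - u\<close>, the identity \<open>c (x / c) - d (y / d) = x - y\<close> says that the
  point \<open>(c, d)\<close> lies on a line with coefficients in \<open>D\<close>.

  Three bounds are played against each other. The number \<open>J\<close> of distinct \<open>(x, y, c, d)\<close> is large because the
  third moment of the representation function of \<open>D\<close> is at most \<open>|Q|\<^sup>2 n\<close>. The number \<open>I\<close> of distinct
  incidences is large because there are few pairs of similar triples in \<open>(A \<inter> cA) \<times> (A \<inter> cA \<inter> dA) \<times> (A \<inter> dA)\<close>.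
  Finally, if each line is represented by about \<open>w = J / I\<close> triples of differences, then there are at most
  \<open>|D|\<^sup>3 / w\<close> lines, and Szemeredi--Trotter with the at most \<open>(n\<^sup>2 / \<Delta>)\<^sup>2\<close> points bounds \<open>I\<close> from above.
\<close>

subsection \<open>Collisions and dyadic levels\<close>

text \<open>Cauchy-Schwarz over the fibres of \<open>f\<close>: the number of collision pairs is the
  sum of the squared fibre sizes.\<close>

lemma card_square_le_collisions:
  assumes "finite T"
  shows "(card T)\<^sup>2 \<le> card (f ` T) * card {(s, t). s \<in> T \<and> t \<in> T \<and> f s = f t}"
proof -
  define F where "F y = {t \<in> T. f t = y}" for y
  have fin: "finite (F y)" for y using assms by (simp add: F_def)
  have "card T = card (\<Union>y\<in>f ` T. F y)"
    by (rule arg_cong[where f=card]) (auto simp: F_def)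
  also have "\<dots> = (\<Sum>y\<in>f ` T. card (F y))"
    by (rule card_UN_disjoint) (use assms fin in \<open>auto simp: F_def\<close>)
  finally have T: "card T = (\<Sum>y\<in>f ` T. card (F y))" .
  have "card {(s, t). s \<in> T \<and> t \<in> T \<and> f s = f t} = card (\<Union>y\<in>f ` T. F y \<times> F y)"
    by (rule arg_cong[where f=card]) (auto simp: F_def)
  also have "\<dots> = (\<Sum>y\<in>f ` T. card (F y \<times> F y))"
    by (rule card_UN_disjoint) (use assms fin in \<open>auto simp: F_def\<close>)
  also have "\<dots> = (\<Sum>y\<in>f ` T. (card (F y))\<^sup>2)"
    by (simp add: card_cartesian_product power2_eq_square)
  finally have P: "card {(s, t). s \<in> T \<and> t \<in> T \<and> f s = f t} = (\<Sum>y\<in>f ` T. (card (F y))\<^sup>2)" .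
  have "(real (card T))\<^sup>2 = (\<Sum>y\<in>f ` T. real (card (F y)))\<^sup>2"
    by (simp add: T)
  also have "\<dots> \<le> (\<Sum>y\<in>f ` T. (real (card (F y)))\<^sup>2) * real (card (f ` T))"
    by (rule sum_squared_le_sum_of_squares)
  also have "\<dots> = real (card (f ` T) * card {(s, t). s \<in> T \<and> t \<in> T \<and> f s = f t})"
    by (simp add: P mult.commute)
  finally show ?thesis
    by (simp only: of_nat_le_iff flip: of_nat_power)
qed

lemma dyadic_level:
  fixes v :: nat
  assumes "1 \<le> v"
  obtains j where "2 ^ j \<le> v" "v < 2 ^ Suc j"
  using ex_power_ivl1[of 2 v] assms by auto

text \<open>The levels \<open>2 ^ j \<le> v t < 2 ^ Suc j\<close> partition \<open>T\<close>, and
  only those with \<open>j \<le> log 2 m\<close> can be nonempty; hence the factor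
  \<open>log 2 m + 1\<close>.\<close>

lemma sum_dyadic_le:
  fixes g :: "'a \<Rightarrow> real" and v :: "'a \<Rightarrow> nat"
  assumes fin: "finite T" and v: "\<And>t. t \<in> T \<Longrightarrow> 1 \<le> v t \<and> v t \<le> m"
    and m: "1 \<le> m"
    and le: "\<And>j. sum g {t \<in> T. 2 ^ j \<le> v t \<and> v t < 2 ^ Suc j} \<le> K"
  shows "sum g T \<le> K * (log 2 m + 1)"
proof -
  define U where "U j = {t \<in> T. 2 ^ j \<le> v t \<and> v t < 2 ^ Suc j}" for j
  define N where "N = nat \<lfloor>log 2 m\<rfloor>"
  have K: "0 \<le> K"
  proof -
    \<comment> \<open>Level \<open>m\<close> is empty because \<open>m < 2 ^ m\<close>, so the
      assumed bound for it reads \<open>0 \<le> K\<close>.\<close>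
    have "{t \<in> T. 2 ^ m \<le> v t \<and> v t < 2 ^ Suc m} = {}"
    proof -
      have "v t < 2 ^ m" if "t \<in> T" for t
        using v[OF that] less_exp[of m] by linarith
      then show ?thesis by fastforce
    qed
    then show ?thesis using le[of m] by (metis sum.empty)
  qed
  have "T = (\<Union>j\<in>{..N}. U j)"
  proof (intro equalityI subsetI)
    fix t assume t: "t \<in> T"
    obtain j where j: "2 ^ j \<le> v t" "v t < 2 ^ Suc j"
      using v[OF t] dyadic_level[of "v t"] by metis
    have "(2::nat) ^ j \<le> m" using j v[OF t] by linarith
    then have "(2::real) ^ j \<le> m" by (metis of_nat_le_iff of_nat_numeral of_nat_power)
    then have "real j \<le> log 2 m" using m by (simp add: le_log_iff powr_realpow)
    then have "j \<le> N" unfolding N_def by (simp add: le_nat_floor)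
    then show "t \<in> (\<Union>j\<in>{..N}. U j)" using t j by (auto simp: U_def)
  qed (auto simp: U_def)
  then have "sum g T = sum g (\<Union>j\<in>{..N}. U j)" by simp
  also have "\<dots> = (\<Sum>j\<in>{..N}. sum g (U j))"
  proof (rule sum.UNION_disjoint)
    show "\<forall>i\<in>{..N}. \<forall>j\<in>{..N}. i \<noteq> j \<longrightarrow> U i \<inter> U j = {}"
    proof (intro ballI impI)
      fix i j :: nat
      have *: "U i \<inter> U j = {}" if "i < j" for i j :: nat
      proof -
        have "(2::nat) ^ Suc i \<le> 2 ^ j" using that by (intro power_increasing) auto
        then show ?thesis unfolding U_def by fastforce
      qed
      assume "i \<noteq> j"
      then show "U i \<inter> U j = {}" using *[of i j] *[of j i] by (cases "i < j") auto
    qed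
  qed (use fin in \<open>auto simp: U_def\<close>)
  also have "\<dots> \<le> (\<Sum>j\<in>{..N}. K)"
    by (rule sum_mono) (use le in \<open>auto simp: U_def\<close>)
  also have "\<dots> = K * (N + 1)" by (simp add: mult.commute)
  also have "\<dots> \<le> K * (log 2 m + 1)"
    using K m by (intro mult_left_mono) (auto simp: N_def)
  finally show ?thesis .
qed

text \<open>The previous bound with \<open>g = 1\<close> and \<open>K\<close> the largest level
  size. The index \<open>j\<close> is unbounded, but level sizes are at most \<open>card T\<close>,
  so a maximum exists.\<close>

lemma dyadic_pigeonhole:
  fixes v :: "'a \<Rightarrow> nat"
  assumes fin: "finite T" and v: "\<And>t. t \<in> T \<Longrightarrow> 1 \<le> v t \<and> v t \<le> m" and m: "1 \<le> m"
  obtains j where "real (card T) \<le> real (card {t \<in> T. 2 ^ j \<le> v t \<and> v t < 2 ^ Suc j}) * (log 2 m + 1)"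
proof -
  define c where "c j = card {t \<in> T. 2 ^ j \<le> v t \<and> v t < 2 ^ Suc j}" for j
  have "c ` UNIV \<subseteq> {..card T}" by (auto simp: c_def intro!: card_mono fin)
  then have cf: "finite (range c)" by (rule finite_subset) auto
  then obtain j where j: "c j = Max (range c)" using Max_in[of "range c"] by (metis UNIV_not_empty image_is_empty rangeE)
  have "(\<Sum>t\<in>T. 1) \<le> real (c j) * (log 2 m + 1)"
  proof (rule sum_dyadic_le[OF fin v m])
    fix i
    have "c i \<le> c j" using j cf by simp
    then show "(\<Sum>t\<in>{t \<in> T. 2 ^ i \<le> v t \<and> v t < 2 ^ Suc i}. 1) \<le> real (c j)"
      by (simp add: c_def)
  qed
  then show ?thesis using that[of j] by (simp add: c_def)
qed

subsection \<open>Incidences between lines and Cartesian products\<close>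

definition rank_in :: "real set \<Rightarrow> real \<Rightarrow> nat" where
  "rank_in A x = card {a \<in> A. a < x}"

lemma rank_mono: "finite A \<Longrightarrow> x \<le> y \<Longrightarrow> rank_in A x \<le> rank_in A y"
  unfolding rank_in_def by (rule card_mono) auto

lemma rank_less: "finite A \<Longrightarrow> x \<in> A \<Longrightarrow> rank_in A x < card A"
  unfolding rank_in_def by (rule psubset_card_mono) auto

lemma rank_strict_mono: "finite A \<Longrightarrow> x \<in> A \<Longrightarrow> x < y \<Longrightarrow> rank_in A x < rank_in A y"
  unfolding rank_in_def by (rule psubset_card_mono) auto

lemma inj_on_rank: "finite A \<Longrightarrow> inj_on (rank_in A) A"
  proof (rule inj_onI)
  fix x y assume "finite A" "x \<in> A" "y \<in> A" "rank_in A x = rank_in A y"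
  then show "x = y"
    using rank_strict_mono[of A x y] rank_strict_mono[of A y x] by (cases x y rule: linorder_cases) auto
qed

text \<open>Runs of \<open>card A div r\<close> consecutive ranks: the cutting of one side of the
  grid. It is defined at every real, so that it is monotone on the whole line.\<close>

definition block :: "nat \<Rightarrow> real set \<Rightarrow> real \<Rightarrow> nat" where
  "block r A x = rank_in A x div (card A div r)"

lemma block_mono: "finite A \<Longrightarrow> x \<le> y \<Longrightarrow> block r A x \<le> block r A y"
  unfolding block_def by (intro div_le_mono rank_mono)

text \<open>Rounding down the block length \<open>w\<close> may create more than \<open>r\<close>
  blocks, but \<open>card A < r * w + r \<le> 2 * r * w\<close> since
  \<open>w \<ge> 1\<close>.\<close>

lemma block_less:
  assumes "finite A" "x \<in> A" "1 \<le> r" "r \<le> card A"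
  shows "block r A x < 2 * r"
proof -
  define w where "w = card A div r"
  have w: "1 \<le> w" using assms by (simp add: w_def div_greater_zero_iff Suc_leI)
  have "card A = r * w + card A mod r" by (simp add: w_def)
  also have "\<dots> < r * w + r" using assms(3) by simp
  also have "\<dots> \<le> 2 * r * w" using w by simp
  finally have "rank_in A x < 2 * r * w" using rank_less[OF assms(1,2)] by linarith
  then show ?thesis using w by (simp add: block_def w_def less_mult_imp_div_less)
qed

lemma card_same_block:
  assumes "finite A" "1 \<le> r" "r \<le> card A"
  shows "real (card {y \<in> A. block r A y = j}) \<le> card A / r"
proof -
  define w where "w = card A div r"
  have w: "1 \<le> w" using assms by (simp add: w_def div_greater_zero_iff Suc_leI)
  have "rank_in A ` {y \<in> A. block r A y = j} \<subseteq> {j * w..<j * w + w}"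
  proof (rule image_subsetI)
    fix y assume "y \<in> {y \<in> A. block r A y = j}"
    then have "rank_in A y div w = j" by (simp add: block_def w_def)
    then show "rank_in A y \<in> {j * w..<j * w + w}"
      using w dividend_less_div_times[of w "rank_in A y"] div_times_less_eq_dividend[of "rank_in A y" w]
      by auto
  qed
  then have "card (rank_in A ` {y \<in> A. block r A y = j}) \<le> card {j * w..<j * w + w}"
    by (intro card_mono) auto
  moreover have "card (rank_in A ` {y \<in> A. block r A y = j}) = card {y \<in> A. block r A y = j}"
    by (rule card_image) (rule inj_on_subset[OF inj_on_rank[OF assms(1)]], auto)
  ultimately have "card {y \<in> A. block r A y = j} \<le> w" by simp
  moreover have "real w \<le> card A / r" unfolding w_def by (rule of_nat_div_le_of_nat)
  ultimately show ?thesis by linarith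
qed

text \<open>A pair stands for a non-vertical line, as slope and intercept; its points in the grid
  are recorded by their abscissae.\<close>

definition line_points :: "real set \<Rightarrow> real set \<Rightarrow> real \<times> real \<Rightarrow> real set" where
  "line_points A B l = {x \<in> A. fst l * x + snd l \<in> B}"

lemma finite_line_points [simp]: "finite A \<Longrightarrow> finite (line_points A B l)"
  by (simp add: line_points_def)

text \<open>One representative per fibre injects into the image; every other point collides with its
  representative.\<close>

lemma card_le_image_plus_collisions:
  assumes "finite P"
  shows "card P \<le> card (f ` P) + card {(x, y). x \<in> P \<and> y \<in> P \<and> x \<noteq> y \<and> f x = f y}"
proof -
  define g where "g x = (SOME y. y \<in> P \<and> f y = f x)" for x
  have g: "g x \<in> P \<and> f (g x) = f x" if "x \<in> P" for x
    unfolding g_def by (rule someI[of _ x]) (use that in auto)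
  have gg: "g x = g y" if "f x = f y" for x y using that by (simp add: g_def)
  define R where "R = {x \<in> P. g x = x}"
  have "inj_on f R" unfolding inj_on_def R_def using gg by (metis (mono_tags, lifting) mem_Collect_eq)
  then have R: "card R \<le> card (f ` P)"
    by (rule card_inj_on_le) (use assms in \<open>auto simp: R_def\<close>)
  have "inj_on (\<lambda>x. (x, g x)) (P - R)" by (rule inj_onI) auto
  then have "card (P - R) \<le> card {(x, y). x \<in> P \<and> y \<in> P \<and> x \<noteq> y \<and> f x = f y}"
  proof (rule card_inj_on_le)
    show "(\<lambda>x. (x, g x)) ` (P - R) \<subseteq> {(x, y). x \<in> P \<and> y \<in> P \<and> x \<noteq> y \<and> f x = f y}"
      using g unfolding R_def by (force dest: sym)
    show "finite {(x, y). x \<in> P \<and> y \<in> P \<and> x \<noteq> y \<and> f x = f y}"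
      by (rule finite_subset[of _ "P \<times> P"]) (use assms in auto)
  qed
  moreover have "card P = card R + card (P - R)"
    using assms card_Un_disjoint[of R "P - R"] by (auto simp: R_def Un_absorb1)
  ultimately show ?thesis using R by linarith
qed

text \<open>A monotone line passes through at most \<open>4 * r\<close> cells. One point is charged
  to each cell met; each further point forms a pair with the representative of its cell.\<close>

lemma card_line_points_le_pairs:
  assumes A: "finite A" and B: "finite B" and r: "1 \<le> r" "r \<le> card A" "r \<le> card B"
    and m: "fst l \<noteq> 0"
  shows "card (line_points A B l) \<le> 4 * r + card {(x, y). x \<in> line_points A B l \<and> y \<in> line_points A B l
     \<and> x \<noteq> y \<and> block r A x = block r A y \<and> block r B (fst l * x + snd l) = block r B (fst l * y + snd l)}"
proof -
  define P where "P = line_points A B l"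
  define h where "h x = fst l * x + snd l" for x
  \<comment> \<open>This numbers the cells along the line. On a falling line the second index
    decreases, so it is reflected; the natural subtraction is exact because indices are below
    \<open>2 * r\<close>. Both summands then grow with \<open>x\<close>, so equal sums force equal
    cells.\<close>
  define f where "f x = (if 0 < fst l then block r A x + block r B (h x)
      else block r A x + (2 * r - block r B (h x)))" for x
  have bA: "block r A x < 2 * r" and bB: "block r B (h x) < 2 * r" if "x \<in> P" for x
    using that block_less A B r by (auto simp: P_def line_points_def h_def)
  have f1: "f x < 4 * r" if "x \<in> P" "0 < fst l" for x
    using bA[OF that(1)] bB[OF that(1)] that by (simp add: f_def)
  have f2: "f x \<in> {1..<4 * r}" if "x \<in> P" "\<not> 0 < fst l" for x
    using bA[OF that(1)] bB[OF that(1)] that by (auto simp: f_def)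
  have "f ` P \<subseteq> {..<4 * r}" using f1 f2 by fastforce
  then have i: "card (f ` P) \<le> 4 * r" using card_mono[of "{..<4 * r}" "f ` P"] by simp
  have eq: "block r A x = block r A y \<and> block r B (h x) = block r B (h y)"
    if "x \<in> P" "y \<in> P" "f x = f y" "x \<le> y" for x y
  proof -
    have a: "block r A x \<le> block r A y" using that A by (intro block_mono)
    show ?thesis
    proof (cases "0 < fst l")
      case True
      then have "h x \<le> h y" using that by (simp add: h_def mult_left_mono)
      then have "block r B (h x) \<le> block r B (h y)" using B by (intro block_mono)
      then show ?thesis using a that(3) True by (simp add: f_def)
    next
      case False
      then have "h y \<le> h x" using that by (simp add: h_def mult_left_mono_neg)
      then have "block r B (h y) \<le> block r B (h x)" using B by (intro block_mono)
      moreover have "block r A x + (2 * r - block r B (h x)) = block r A y + (2 * r - block r B (h y))"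
        using that(3) False by (simp add: f_def)
      ultimately show ?thesis using a bB[OF that(1)] bB[OF that(2)] by linarith
    qed
  qed
  have fP: "finite P" using A by (simp add: P_def)
  have "card P \<le> card (f ` P) + card {(x, y). x \<in> P \<and> y \<in> P \<and> x \<noteq> y \<and> f x = f y}"
    by (rule card_le_image_plus_collisions[OF fP])
  also have "card {(x, y). x \<in> P \<and> y \<in> P \<and> x \<noteq> y \<and> f x = f y}
     \<le> card {(x, y). x \<in> P \<and> y \<in> P \<and> x \<noteq> y \<and> block r A x = block r A y \<and> block r B (h x) = block r B (h y)}"
  proof (rule card_mono)
    show "finite {(x, y). x \<in> P \<and> y \<in> P \<and> x \<noteq> y \<and> block r A x = block r A y \<and> block r B (h x) = block r B (h y)}"
      by (rule finite_subset[of _ "P \<times> P"]) (use fP in auto)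
    have "block r A x = block r A y \<and> block r B (h x) = block r B (h y)"
      if "x \<in> P" "y \<in> P" "f x = f y" for x y
      using eq[of x y] eq[of y x] that linear[of x y] by metis
    then show "{(x, y). x \<in> P \<and> y \<in> P \<and> x \<noteq> y \<and> f x = f y}
     \<subseteq> {(x, y). x \<in> P \<and> y \<in> P \<and> x \<noteq> y \<and> block r A x = block r A y \<and> block r B (h x) = block r B (h y)}"
      by blast
  qed
  finally show ?thesis using i by (simp add: P_def h_def)
qed

lemma line_eq_if_two_points:
  fixes l l' :: "real \<times> real"
  assumes "fst l * x + snd l = fst l' * x + snd l'" "fst l * y + snd l = fst l' * y + snd l'" "x \<noteq> y"
  shows "l = l'"
proof -
  have "(fst l - fst l') * (x - y) = 0" using assms(1,2) by (simp add: algebra_simps)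
  then have "fst l = fst l'" using assms(3) by simp
  with assms(1) show ?thesis by (simp add: prod_eq_iff)
qed

text \<open>Two distinct points determine their line, so the same-cell pairs of all lines together
  are at most the same-cell pairs of grid points: each of the \<open>card A * card B\<close> points
  has at most \<open>(card A / r) * (card B / r)\<close> partners.\<close>

lemma grid_incidences_le:
  assumes A: "finite A" and B: "finite B" and L: "finite L" and m: "\<And>l. l \<in> L \<Longrightarrow> fst l \<noteq> 0"
    and r: "1 \<le> r"
  shows "real (\<Sum>l\<in>L. card (line_points A B l)) \<le> 4 * real r * card L + (real (card A) * card B)\<^sup>2 / (real r)\<^sup>2"
proof (cases "r \<le> card A \<and> r \<le> card B")
  case False
  \<comment> \<open>Here \<open>r\<close> exceeds one side of the grid, and a line that is neither
    vertical nor horizontal has at most one point per row and per column.\<close>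
  have "card (line_points A B l) \<le> 4 * r" if "l \<in> L" for l
  proof -
    have "card (line_points A B l) \<le> card A" using A by (auto simp: line_points_def intro: card_mono)
    moreover have "card (line_points A B l) \<le> card B"
    proof (rule card_inj_on_le)
      show "inj_on (\<lambda>x. fst l * x + snd l) (line_points A B l)"
        by (rule inj_onI) (use m[OF that] in simp)
    qed (use B in \<open>auto simp: line_points_def\<close>)
    ultimately show ?thesis using False by linarith
  qed
  then have "(\<Sum>l\<in>L. card (line_points A B l)) \<le> card L * (4 * r)"
    using sum_bounded_above[of L "\<lambda>l. card (line_points A B l)" "4 * r"] by simp
  then have "real (\<Sum>l\<in>L. card (line_points A B l)) \<le> real (card L * (4 * r))"
    by (simp only: of_nat_le_iff)
  then have "real (\<Sum>l\<in>L. card (line_points A B l)) \<le> 4 * real r * card L"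
    by (simp add: algebra_simps)
  moreover have "0 \<le> (real (card A) * card B)\<^sup>2 / (real r)\<^sup>2" by simp
  ultimately show ?thesis by linarith
next
  case True
  define C where "C l = {(x, y). x \<in> line_points A B l \<and> y \<in> line_points A B l
     \<and> x \<noteq> y \<and> block r A x = block r A y \<and> block r B (fst l * x + snd l) = block r B (fst l * y + snd l)}" for l
  define bA where "bA x = {y \<in> A. block r A y = block r A x}" for x
  define bB where "bB x = {y \<in> B. block r B y = block r B x}" for x
  have finC: "finite (C l)" for l
    by (rule finite_subset[of _ "A \<times> A"]) (use A in \<open>auto simp: C_def line_points_def\<close>)
  have "(\<Sum>l\<in>L. card (line_points A B l)) \<le> (\<Sum>l\<in>L. 4 * r + card (C l))"
    by (rule sum_mono) (use card_line_points_le_pairs[OF A B r] True m in \<open>auto simp: C_def\<close>)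
  also have "\<dots> = 4 * r * card L + (\<Sum>l\<in>L. card (C l))" by (simp add: sum.distrib)
  also have "(\<Sum>l\<in>L. card (C l)) = card (SIGMA l:L. C l)"
    using L finC by simp
  also have "\<dots> \<le> card (SIGMA (x, y):A \<times> B. bA x \<times> bB y)"
  proof (rule card_inj_on_le)
    let ?f = "\<lambda>(l, x, y). ((x, fst l * x + snd l), (y :: real, fst l * y + snd l))"
    show "inj_on ?f (SIGMA l:L. C l)"
      proof (rule inj_onI)
      fix p q assume "p \<in> (SIGMA l:L. C l)" "q \<in> (SIGMA l:L. C l)" "?f p = ?f q"
      moreover obtain l x y l' x' y' where "p = (l, x, y)" "q = (l', x', y')" by (metis prod_cases3)
      ultimately show "p = q"
        using line_eq_if_two_points[of l x l' y] by (auto simp: C_def simp del: split_paired_All)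
    qed
    show "?f ` (SIGMA l:L. C l) \<subseteq> (SIGMA (x, y):A \<times> B. bA x \<times> bB y)"
      by (auto simp: C_def line_points_def bA_def bB_def)
    show "finite (SIGMA (x, y):A \<times> B. bA x \<times> bB y)"
      using A B by (auto simp: bA_def bB_def)
  qed
  also have "\<dots> = (\<Sum>p\<in>A \<times> B. card (bA (fst p)) * card (bB (snd p)))"
    using A B by (subst card_SigmaI) (auto simp: bA_def bB_def card_cartesian_product intro!: sum.cong)
  finally have *: "(\<Sum>l\<in>L. card (line_points A B l)) \<le> 4 * r * card L + (\<Sum>p\<in>A \<times> B. card (bA (fst p)) * card (bB (snd p)))"
    by simp
  have "real (\<Sum>p\<in>A \<times> B. card (bA (fst p)) * card (bB (snd p)))
     = (\<Sum>p\<in>A \<times> B. real (card (bA (fst p))) * real (card (bB (snd p))))" by simp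
  also have "\<dots> \<le> (\<Sum>p\<in>A \<times> B. (real (card A) / r) * (real (card B) / r))"
    by (rule sum_mono, rule mult_mono)
      (use card_same_block[OF A r] card_same_block[OF B r] True in \<open>auto simp: bA_def bB_def\<close>)
  also have "\<dots> = (real (card A) * card B)\<^sup>2 / (real r)\<^sup>2"
    by (simp add: card_cartesian_product power2_eq_square)
  finally have "real (\<Sum>p\<in>A \<times> B. card (bA (fst p)) * card (bB (snd p))) \<le> (real (card A) * card B)\<^sup>2 / (real r)\<^sup>2" .
  moreover have "real (\<Sum>l\<in>L. card (line_points A B l)) \<le> real (4 * r * card L + (\<Sum>p\<in>A \<times> B. card (bA (fst p)) * card (bB (snd p))))"
    using * by (simp only: of_nat_le_iff)
  ultimately show ?thesis by simp
qed

lemma szemeredi_trotter_grid: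
  assumes A: "finite A" and B: "finite B" and L: "finite L" and m: "\<And>l. l \<in> L \<Longrightarrow> fst l \<noteq> 0"
    and I: "I \<le> real (\<Sum>l\<in>L. card (line_points A B l))"
  shows "I < 8 * card L \<or> I ^ 3 \<le> 512 * (real (card A) * card B)\<^sup>2 * (real (card L))\<^sup>2"
proof (cases "I < 8 * card L \<or> card L = 0")
  case True
  then show ?thesis
  proof
    assume "card L = 0"
    then have "L = {}" using L by simp
    with I have "I \<le> 0" by simp
    then have "I ^ 3 \<le> 0" by (simp add: power3_eq_cube mult_nonneg_nonpos zero_le_mult_iff mult_le_0_iff)
    then show ?thesis using \<open>L = {}\<close> by simp
  qed simp
next
  case False
  define l where "l = real (card L)"
  have l: "0 < l" and Il: "8 * l \<le> I" using False by (auto simp: l_def)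
  define N where "N = real (card A) * card B"
  define r where "r = nat \<lfloor>I / (8 * l)\<rfloor>"
  have x: "1 \<le> I / (8 * l)" using l Il by (simp add: field_simps)
  have r1: "1 \<le> r" unfolding r_def using x by (simp add: le_nat_floor)
  have r2: "r \<le> I / (8 * l)" unfolding r_def using x by simp
  \<comment> \<open>Rounding down a number that is at least 1 loses at most a factor of 2.\<close>
  have "I / (8 * l) < real r + 1" unfolding r_def using x by linarith
  then have r3: "I / (16 * l) \<le> r" using r1 by (simp add: field_simps)
  have "I \<le> 4 * r * l + N\<^sup>2 / (real r)\<^sup>2"
    using grid_incidences_le[OF A B L m r1] I by (simp add: N_def l_def)
  also have "4 * r * l \<le> I / 2" using r2 l by (simp add: field_simps)
  also have "N\<^sup>2 / (real r)\<^sup>2 \<le> N\<^sup>2 / (I / (16 * l))\<^sup>2"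
    using r1 r3 l Il by (intro divide_left_mono power_mono mult_pos_pos) auto
  also have "\<dots> = 256 * N\<^sup>2 * l\<^sup>2 / I\<^sup>2" by (simp add: power_divide power_mult_distrib)
  finally have "I / 2 \<le> 256 * N\<^sup>2 * l\<^sup>2 / I\<^sup>2" by simp
  then have "I ^ 3 \<le> 512 * N\<^sup>2 * l\<^sup>2"
    using l Il by (simp add: field_simps power2_eq_square power3_eq_cube)
  then show ?thesis by (simp add: N_def l_def)
qed

section \<open>Elementary facts on difference and ratio sets\<close>

lemma finite_difference_set: "finite A \<Longrightarrow> finite (difference_set A)"
  by (rule finite_subset[of _ "(\<lambda>(a, b). a - b) ` (A \<times> A)"]) (auto simp: difference_set_def)

lemma finite_ratio_set: "finite A \<Longrightarrow> finite (ratio_set A)"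
  by (rule finite_subset[of _ "(\<lambda>(a, b). a / b) ` (A \<times> A)"]) (auto simp: ratio_set_def)

lemma card_le_card_ratio_set:
  assumes "finite A" "0 \<notin> A"
  shows "card A \<le> card (ratio_set A)"
proof (cases "A = {}")
  case False
  then obtain b where b: "b \<in> A" by blast
  have "b \<noteq> 0" using b assms by metis
  show ?thesis
  proof (rule card_inj_on_le)
    show "inj_on (\<lambda>a. a / b) A" by (rule inj_onI) (use \<open>b \<noteq> 0\<close> in simp)
    show "(\<lambda>a. a / b) ` A \<subseteq> ratio_set A" using b \<open>b \<noteq> 0\<close> by (auto simp: ratio_set_def)
  qed (rule finite_ratio_set[OF assms(1)])
qed simp

subsection \<open>The third moment of the representation function of differences\<close>

text \<open>On a dyadic level \<open>X\<close> of multiplicity about \<open>t\<close>, write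
  \<open>d = a - a'\<close> as \<open>d = c * (a / c) - a'\<close> for every
  \<open>c \<in> A\<close>. So the point \<open>(a / c, d)\<close> of
  \<open>ratio_set A \<times> X\<close> lies on the line of slope \<open>c\<close> and intercept
  \<open>- a'\<close>. This gives at least \<open>card X * t * n\<close> incidences with
  \<open>n\<^sup>2\<close> lines, and the incidence bound yields
  \<open>card X * t ^ 3 \<le> 512 * q\<^sup>2 * n\<close>.\<close>

lemma third_energy_le:
  assumes A: "finite A" and A0: "0 \<notin> A" and ne: "1 \<le> card A"
  shows "(\<Sum>d\<in>difference_set A. real (card {a \<in> A. a - d \<in> A}) ^ 3)
    \<le> 4096 * (real (card (ratio_set A)))\<^sup>2 * card A * (log 2 (card A) + 1)"
proof (rule sum_dyadic_le[where v = "\<lambda>d. card {a \<in> A. a - d \<in> A}"])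
  fix j
  let ?R = "\<lambda>d. {a \<in> A. a - d \<in> A}"
  define n where "n = real (card A)"
  define q where "q = real (card (ratio_set A))"
  define t where "t = (2::real) ^ j"
  define X where "X = {d \<in> difference_set A. 2 ^ j \<le> card (?R d) \<and> card (?R d) < 2 ^ Suc j}"
  define L where "L = (\<lambda>(a, b). (a, - b)) ` (A \<times> A)"
  have finX: "finite X" using finite_difference_set[OF A] by (simp add: X_def)
  have finL: "finite L" using A by (simp add: L_def)
  have "card L = card (A \<times> A)" unfolding L_def by (rule card_image) (auto simp: inj_on_def)
  then have cL: "real (card L) = n\<^sup>2" by (simp add: n_def power2_eq_square card_cartesian_product)
  have n1: "1 \<le> n" using ne by (simp add: n_def)
  have nq: "n \<le> q" using card_le_card_ratio_set[OF A A0] by (simp add: n_def q_def)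
  have t0: "0 < t" by (simp add: t_def)
  have lo: "t \<le> card (?R d)" and hi: "card (?R d) \<le> 2 * t" if "d \<in> X" for d
  proof -
    from that have "2 ^ j \<le> card (?R d)" "card (?R d) < 2 ^ Suc j" by (auto simp: X_def)
    then show "t \<le> card (?R d)" "card (?R d) \<le> 2 * t"
      unfolding t_def by (metis of_nat_le_iff of_nat_numeral of_nat_power,
        metis less_imp_le of_nat_le_iff of_nat_numeral of_nat_power power_Suc)
  qed
  have "card (SIGMA d:X. ?R d \<times> A) \<le> card (SIGMA l:L. line_points (ratio_set A) X l)"
  proof (rule card_inj_on_le)
    let ?f = "\<lambda>(d, a, c). ((c, - (a - d)), a / c)"
    have "inj_on ?f (X \<times> A \<times> A)"
      by (rule inj_onI) (use A0 in auto)
    then show "inj_on ?f (SIGMA d:X. ?R d \<times> A)" by (rule inj_on_subset) auto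
    show "?f ` (SIGMA d:X. ?R d \<times> A) \<subseteq> (SIGMA l:L. line_points (ratio_set A) X l)"
    proof (rule image_subsetI)
      fix p assume p: "p \<in> (SIGMA d:X. ?R d \<times> A)"
      obtain d a c where [simp]: "p = (d, a, c)" by (metis prod_cases3)
      have *: "d \<in> X" "a \<in> A" "a - d \<in> A" "c \<in> A" using p by auto
      then have "c \<noteq> 0" using A0 by metis
      then have "a / c \<in> ratio_set A" using * by (auto simp: ratio_set_def)
      moreover have "(c, - (a - d)) \<in> L" unfolding L_def using * by (intro image_eqI[of _ _ "(c, a - d)"]) auto
      ultimately show "?f p \<in> (SIGMA l:L. line_points (ratio_set A) X l)"
        using * \<open>c \<noteq> 0\<close> by (simp add: line_points_def)
    qed
    show "finite (SIGMA l:L. line_points (ratio_set A) X l)"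
      using finL finite_ratio_set[OF A] by auto
  qed
  moreover have "card (SIGMA l:L. line_points (ratio_set A) X l) = (\<Sum>l\<in>L. card (line_points (ratio_set A) X l))"
    using finL finite_ratio_set[OF A] by simp
  moreover have "card (SIGMA d:X. ?R d \<times> A) = (\<Sum>d\<in>X. card (?R d) * card A)"
    using finX A by (simp add: card_cartesian_product)
  ultimately have "real (\<Sum>d\<in>X. card (?R d) * card A) \<le> real (\<Sum>l\<in>L. card (line_points (ratio_set A) X l))"
    by (simp only: of_nat_le_iff)
  moreover have "real (\<Sum>d\<in>X. card (?R d) * card A) = (\<Sum>d\<in>X. real (card (?R d)) * n)" by (simp add: n_def)
  moreover have "(\<Sum>d\<in>X. t * n) \<le> (\<Sum>d\<in>X. real (card (?R d)) * n)"
    by (intro sum_mono mult_right_mono lo) (auto simp: n_def)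
  ultimately have I: "card X * (t * n) \<le> real (\<Sum>l\<in>L. card (line_points (ratio_set A) X l))"
    by simp
  have slope: "fst l \<noteq> 0" if "l \<in> L" for l using that A0 by (auto simp: L_def)
  have main: "card X * t ^ 3 \<le> 512 * q\<^sup>2 * n"
    using szemeredi_trotter_grid[OF finite_ratio_set[OF A] finX finL slope I]
  proof
    \<comment> \<open>With few incidences \<open>card X * t < 8 * n\<close>, and the missing factor
      \<open>t\<^sup>2\<close> is supplied by \<open>t \<le> n \<le> q\<close>.\<close>
    assume "card X * (t * n) < 8 * card L"
    then have "(card X * t) * n < (8 * n) * n" by (simp add: cL power2_eq_square algebra_simps)
    then have Xt: "card X * t < 8 * n" using n1 by simp
    show ?thesis
    proof (cases "X = {}")
      case False
      then obtain d where "d \<in> X" by blast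
      then have "t \<le> card (?R d)" by (rule lo)
      also have "\<dots> \<le> n" using A by (auto simp: n_def intro: card_mono)
      finally have "t \<le> n" .
      then have "t\<^sup>2 \<le> n\<^sup>2" using t0 by (intro power_mono) auto
      then have "(card X * t) * t\<^sup>2 \<le> (8 * n) * n\<^sup>2" using Xt t0 n1 by (rule_tac mult_mono) auto
      also have "\<dots> \<le> (8 * n) * q\<^sup>2" using nq n1 by (intro mult_left_mono power_mono) auto
      also have "\<dots> \<le> 512 * q\<^sup>2 * n" using n1 by (simp add: algebra_simps)
      finally show ?thesis by (simp add: power3_eq_cube power2_eq_square algebra_simps)
    qed (use n1 in simp)
  next
    assume a: "(card X * (t * n)) ^ 3 \<le> 512 * (real (card (ratio_set A)) * card X)\<^sup>2 * (real (card L))\<^sup>2"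
    show ?thesis
    proof (cases "X = {}")
      case False
      then have x: "0 < real (card X)" using finX by (simp add: card_gt_0_iff)
      have "(real (card X))\<^sup>2 * n ^ 3 * (card X * t ^ 3) \<le> (real (card X))\<^sup>2 * n ^ 3 * (512 * q\<^sup>2 * n)"
        using a by (simp add: cL q_def algebra_simps power2_eq_square power3_eq_cube)
      then show ?thesis using x n1 by (subst (asm) mult_le_cancel_left_pos) auto
    qed (use n1 in simp)
  qed
  have "(\<Sum>d\<in>X. real (card (?R d)) ^ 3) \<le> (\<Sum>d\<in>X. (2 * t) ^ 3)"
    by (intro sum_mono power_mono hi) auto
  also have "\<dots> = 8 * (card X * t ^ 3)" by (simp add: power_mult_distrib)
  also have "\<dots> \<le> 4096 * q\<^sup>2 * n" using main by linarith
  finally show "(\<Sum>d\<in>{d \<in> difference_set A. 2 ^ j \<le> card (?R d) \<and> card (?R d) < 2 ^ Suc j}. real (card (?R d)) ^ 3)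
     \<le> 4096 * (real (card (ratio_set A)))\<^sup>2 * card A"
    unfolding X_def q_def n_def .
next
  fix d assume "d \<in> difference_set A"
  then obtain a a' where "d = a - a'" "a \<in> A" "a' \<in> A" by (auto simp: difference_set_def)
  then have "a \<in> {a \<in> A. a - d \<in> A}" by simp
  then have "{a \<in> A. a - d \<in> A} \<noteq> {}" by blast
  then have "0 < card {a \<in> A. a - d \<in> A}" using A by (simp add: card_gt_0_iff)
  then show "1 \<le> card {a \<in> A. a - d \<in> A} \<and> card {a \<in> A. a - d \<in> A} \<le> card A"
    using A by (auto intro: card_mono)
qed (use A ne in \<open>auto intro: finite_difference_set\<close>)

subsection \<open>Similar triples\<close>

text \<open>Seen as affine maps, these are the invertible ones that send at least two points of
  \<open>X\<close> into \<open>X\<close>.\<close>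

definition rich_lines :: "real set \<Rightarrow> (real \<times> real) set" where
  "rich_lines X = {l. fst l \<noteq> 0 \<and> 2 \<le> card (line_points X X l)}"

lemma finite_rich_lines:
  assumes "finite X"
  shows "finite (rich_lines X)"
proof (rule finite_subset)
  \<comment> \<open>Slope and intercept of the line through \<open>(x, x')\<close> and
    \<open>(y, y')\<close>.\<close>
  let ?f = "\<lambda>(x, x', y, y'). ((y' - x') / (y - x), x' - (y' - x') / (y - x) * x)"
  show "rich_lines X \<subseteq> ?f ` (X \<times> X \<times> X \<times> X)"
  proof
    fix l assume "l \<in> rich_lines X"
    then have "\<not> card (line_points X X l) \<le> Suc 0" by (simp add: rich_lines_def)
    then obtain x y where "x \<in> line_points X X l" "y \<in> line_points X X l" "x \<noteq> y"
      using card_le_Suc0_iff_eq[of "line_points X X l"] assms by auto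
    then have "l = ?f (x, fst l * x + snd l, y, fst l * y + snd l)"
      "(x, fst l * x + snd l, y, fst l * y + snd l) \<in> X \<times> X \<times> X \<times> X"
      by (auto simp: line_points_def prod_eq_iff field_simps)
    then show "l \<in> ?f ` (X \<times> X \<times> X \<times> X)" by (rule image_eqI)
  qed
qed (use assms in auto)

text \<open>Counts a line with a point over \<open>B\<close> and a different point over
  \<open>X\<close>; the two points determine the line.\<close>

lemma sum_line_points_pairs_le:
  assumes X: "finite X" and B: "B \<subseteq> X" and L: "finite L"
  shows "(\<Sum>l\<in>L. card (line_points B B l) * (card (line_points X X l) - 1)) \<le> (card B)\<^sup>2 * (card X)\<^sup>2"
proof -
  have finB: "finite B" using B X by (rule finite_subset)
  have sub: "u \<in> line_points X X l" if "u \<in> line_points B B l" for u l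
    using that B by (auto simp: line_points_def)
  have "(\<Sum>l\<in>L. card (line_points B B l) * (card (line_points X X l) - 1))
     = (\<Sum>l\<in>L. \<Sum>u\<in>line_points B B l. card (line_points X X l - {u}))"
    by (intro sum.cong refl) (simp add: sub card_Diff_singleton)
  also have "\<dots> = card (SIGMA l:L. SIGMA u:line_points B B l. line_points X X l - {u})"
    using L X finB by simp
  also have "\<dots> \<le> card ((B \<times> B) \<times> X \<times> X)"
  proof (rule card_inj_on_le)
    let ?f = "\<lambda>(l, u, x). ((u, fst l * u + snd l), x, fst l * x + snd l)"
    show "inj_on ?f (SIGMA l:L. SIGMA u:line_points B B l. line_points X X l - {u})"
    proof (rule inj_onI)
      fix p q assume "p \<in> (SIGMA l:L. SIGMA u:line_points B B l. line_points X X l - {u})" "?f p = ?f q"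
      moreover obtain l x y l' x' y' where "p = (l, x, y)" "q = (l', x', y')" by (metis prod_cases3)
      ultimately show "p = q"
        using line_eq_if_two_points[of l x l' y] by (auto simp del: split_paired_All)
    qed
    show "?f ` (SIGMA l:L. SIGMA u:line_points B B l. line_points X X l - {u}) \<subseteq> (B \<times> B) \<times> X \<times> X"
      by (auto simp: line_points_def)
    show "finite ((B \<times> B) \<times> X \<times> X)" using X finB by auto
  qed
  also have "\<dots> = (card B)\<^sup>2 * (card X)\<^sup>2" by (simp add: card_cartesian_product power2_eq_square)
  finally show ?thesis .
qed

text \<open>Incidences in \<open>X \<times> X\<close> bound the number of lines of the level, and
  incidences in \<open>B \<times> B\<close> then bound \<open>\<iota>\<close>. The point is that the
  result is linear in \<open>card B\<close>, which makes it summable over pairs of dilates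
  later.\<close>

lemma sum_rich_lines_level_le:
  fixes j :: nat
  assumes X: "finite X" and B: "B \<subseteq> X"
  defines "L \<equiv> {l \<in> rich_lines X. 2 ^ j \<le> card (line_points X X l) \<and> card (line_points X X l) < 2 ^ Suc j}"
  shows "(\<Sum>l\<in>L. real (card (line_points B B l)) * (real (card (line_points X X l)))\<^sup>2)
     \<le> 2048 * real (card B) * real (card X) ^ 3"
proof -
  define n where "n = real (card X)"
  define b where "b = real (card B)"
  define t where "t = (2::real) ^ j"
  define \<iota> where "\<iota> = (\<Sum>l\<in>L. real (card (line_points B B l)))"
  have finB: "finite B" using B X by (rule finite_subset)
  have finL: "finite L" using finite_rich_lines[OF X] by (simp add: L_def)
  have bn: "0 \<le> b" "b \<le> n" using card_mono[OF X B] by (auto simp: b_def n_def)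
  have t0: "0 < t" by (simp add: t_def)
  have i0: "0 \<le> \<iota>" by (simp add: \<iota>_def sum_nonneg)
  have slope: "fst l \<noteq> 0" if "l \<in> L" for l using that by (auto simp: L_def rich_lines_def)
  have lo: "t \<le> card (line_points X X l)" and hi: "card (line_points X X l) \<le> 2 * t"
    and half: "t / 2 \<le> real (card (line_points X X l) - 1)" if "l \<in> L" for l
  proof -
    from that have "2 ^ j \<le> card (line_points X X l)" "card (line_points X X l) < 2 ^ Suc j"
      and 2: "2 \<le> card (line_points X X l)" by (auto simp: L_def rich_lines_def)
    then show a: "t \<le> card (line_points X X l)" "card (line_points X X l) \<le> 2 * t"
      unfolding t_def by (metis of_nat_le_iff of_nat_numeral of_nat_power,
        metis less_imp_le of_nat_le_iff of_nat_numeral of_nat_power power_Suc)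
    show "t / 2 \<le> real (card (line_points X X l) - 1)" using a 2 by (simp add: of_nat_diff)
  qed
  have triv: "(\<Sum>l\<in>L. real (card (line_points C C l))) * (t / 2) \<le> (real (card C))\<^sup>2 * n\<^sup>2" if "C \<subseteq> X" for C
  proof -
    have "(\<Sum>l\<in>L. real (card (line_points C C l))) * (t / 2)
       \<le> (\<Sum>l\<in>L. real (card (line_points C C l)) * real (card (line_points X X l) - 1))"
      unfolding sum_distrib_right by (intro sum_mono mult_left_mono half) auto
    also have "\<dots> = real (\<Sum>l\<in>L. card (line_points C C l) * (card (line_points X X l) - 1))" by simp
    also have "\<dots> \<le> real ((card C)\<^sup>2 * (card X)\<^sup>2)"
      using sum_line_points_pairs_le[OF X that finL] by (simp only: of_nat_le_iff)
    finally show ?thesis by (simp add: n_def)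
  qed
  have LX: "card L * t \<le> (\<Sum>l\<in>L. real (card (line_points X X l)))"
    using sum_mono[of L "\<lambda>_. t" "\<lambda>l. real (card (line_points X X l))"] lo by simp
  have rich: "card L * t ^ 3 \<le> 512 * n ^ 4"
  proof -
    have "card L * t \<le> real (\<Sum>l\<in>L. card (line_points X X l))" using LX by simp
    from szemeredi_trotter_grid[OF X X finL slope this] show ?thesis
    proof
      assume a: "card L * t < 8 * card L"
      \<comment> \<open>In the degenerate alternative \<open>t\<close> is bounded, so the elementary
        pair count \<open>triv\<close> already suffices.\<close>
      have "t < 8" using a mult_left_mono[of 8 t "real (card L)"] by linarith
      have "(card L * t) * (t / 2) \<le> n\<^sup>2 * n\<^sup>2"
        using LX t0 triv[of X] by (intro order_trans[OF mult_right_mono[OF LX]]) (auto simp: n_def)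
      then have "card L * t\<^sup>2 \<le> 2 * n ^ 4" by (simp add: power2_eq_square power4_eq_xxxx)
      then have "card L * t\<^sup>2 * t \<le> 2 * n ^ 4 * 8" using \<open>t < 8\<close> t0 by (rule_tac mult_mono) auto
      moreover have "16 * n ^ 4 \<le> 512 * n ^ 4" by (rule mult_right_mono) auto
      ultimately have "card L * t\<^sup>2 * t \<le> 512 * n ^ 4" by linarith
      then show ?thesis by (simp add: power2_eq_square power3_eq_cube mult.assoc)
    next
      assume a: "(card L * t) ^ 3 \<le> 512 * (real (card X) * card X)\<^sup>2 * (real (card L))\<^sup>2"
      show ?thesis
      proof (cases "card L = 0")
        case False
        then have l: "0 < (real (card L))\<^sup>2" by simp
        have "(real (card L))\<^sup>2 * (card L * t ^ 3) \<le> (real (card L))\<^sup>2 * (512 * n ^ 4)"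
          using a by (simp add: n_def algebra_simps power2_eq_square power3_eq_cube power4_eq_xxxx)
        then show ?thesis using l by (subst (asm) mult_le_cancel_left_pos)
      qed (simp add: n_def)
    qed
  qed
  have "t\<^sup>2 * \<iota> \<le> 512 * (b * n ^ 3)"
  proof -
    have "\<iota> \<le> real (\<Sum>l\<in>L. card (line_points B B l))" by (simp add: \<iota>_def)
    from szemeredi_trotter_grid[OF finB finB finL slope this] show ?thesis
    proof
      \<comment> \<open>The square is split so that one factor is bounded through
        \<open>rich\<close> and the other through \<open>triv\<close>, giving the geometric mean of
        the two bounds.\<close>
      assume a: "\<iota> < 8 * card L"
      have "(t\<^sup>2 * \<iota>)\<^sup>2 = (t ^ 3 * \<iota>) * (t * \<iota>)" by (simp add: power2_eq_square power3_eq_cube)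
      also have "\<dots> \<le> (t ^ 3 * (8 * card L)) * (2 * (b\<^sup>2 * n\<^sup>2))"
      proof (rule mult_mono)
        show "t * \<iota> \<le> 2 * (b\<^sup>2 * n\<^sup>2)" using triv[OF B] by (simp add: \<iota>_def b_def mult.commute)
      qed (use a t0 i0 in auto)
      also have "\<dots> = 16 * b\<^sup>2 * n\<^sup>2 * (card L * t ^ 3)" by simp
      also have "\<dots> \<le> 16 * b\<^sup>2 * n\<^sup>2 * (512 * n ^ 4)" by (intro mult_left_mono rich) auto
      also have "\<dots> = 8192 * (b * n ^ 3)\<^sup>2" by (simp add: power2_eq_square power3_eq_cube power4_eq_xxxx)
      also have "\<dots> \<le> (512 * (b * n ^ 3))\<^sup>2" unfolding power_mult_distrib by (intro mult_right_mono) auto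
      finally show ?thesis by (rule power2_le_imp_le) (use bn in \<open>auto simp: n_def\<close>)
    next
      \<comment> \<open>The incidence bound yields \<open>b ^ 4 * n ^ 8\<close>; trading one
        \<open>b\<close> for \<open>n\<close> turns this into the cube of
        \<open>b * n ^ 3\<close>.\<close>
      assume a: "\<iota> ^ 3 \<le> 512 * (real (card B) * card B)\<^sup>2 * (real (card L))\<^sup>2"
      have "(t\<^sup>2 * \<iota>) ^ 3 = t ^ 6 * \<iota> ^ 3" by (simp add: power_mult_distrib flip: power_mult)
      also have "\<dots> \<le> t ^ 6 * (512 * (b * b)\<^sup>2 * (real (card L))\<^sup>2)"
        using a by (intro mult_left_mono) (auto simp: b_def)
      also have "\<dots> = 512 * b ^ 4 * (card L * t ^ 3)\<^sup>2" by (simp add: power_mult_distrib eval_nat_numeral)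
      also have "\<dots> \<le> 512 * b ^ 4 * (512 * n ^ 4)\<^sup>2" using rich t0 by (intro mult_left_mono power_mono) auto
      also have "\<dots> = 512 ^ 3 * b ^ 3 * n ^ 8 * b" by (simp add: power_mult_distrib eval_nat_numeral)
      also have "\<dots> \<le> 512 ^ 3 * b ^ 3 * n ^ 8 * n" using bn by (intro mult_left_mono) auto
      also have "\<dots> = (512 * (b * n ^ 3)) ^ 3" by (simp add: power_mult_distrib eval_nat_numeral)
      finally have "(t\<^sup>2 * \<iota>) ^ Suc 2 \<le> (512 * (b * n ^ 3)) ^ Suc 2"
        by (simp add: numeral_3_eq_3 numeral_2_eq_2)
      then show ?thesis by (rule power_le_imp_le_base) (use bn in \<open>auto simp: n_def\<close>)
    qed
  qed
  moreover have "(\<Sum>l\<in>L. real (card (line_points B B l)) * (real (card (line_points X X l)))\<^sup>2)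
     \<le> (\<Sum>l\<in>L. real (card (line_points B B l)) * (2 * t)\<^sup>2)"
    by (intro sum_mono mult_left_mono power_mono hi) auto
  moreover have "\<dots> = 4 * (t\<^sup>2 * \<iota>)" by (simp add: \<iota>_def sum_distrib_right sum_distrib_left algebra_simps)
  ultimately show ?thesis by (simp add: b_def n_def)
qed

lemma sum_rich_lines_le:
  assumes X: "finite X" and B: "B \<subseteq> X" and m: "card X \<le> m" "1 \<le> m"
  shows "(\<Sum>l\<in>rich_lines X. real (card (line_points B B l)) * (real (card (line_points X X l)))\<^sup>2)
     \<le> 2048 * real (card B) * real m ^ 3 * (log 2 m + 1)"
proof (rule sum_dyadic_le[where v = "\<lambda>l. card (line_points X X l)", OF finite_rich_lines[OF X]])
  fix l assume "l \<in> rich_lines X"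
  moreover have "card (line_points X X l) \<le> card X" using X by (auto simp: line_points_def intro: card_mono)
  ultimately show "1 \<le> card (line_points X X l) \<and> card (line_points X X l) \<le> m"
    using m by (auto simp: rich_lines_def)
next
  fix j
  have "2048 * real (card B) * real (card X) ^ 3 \<le> 2048 * real (card B) * real m ^ 3"
    using m by (intro mult_left_mono power_mono) auto
  then show "(\<Sum>l\<in>{l \<in> rich_lines X. 2 ^ j \<le> card (line_points X X l) \<and> card (line_points X X l) < 2 ^ Suc j}.
    real (card (line_points B B l)) * (real (card (line_points X X l)))\<^sup>2) \<le> 2048 * real (card B) * real m ^ 3"
    using sum_rich_lines_level_le[OF X B, of j] by linarith
qed (use m in auto)

text \<open>The affine map fixed by sending \<open>a\<close> to \<open>a'\<close> and
  \<open>u\<close> to \<open>u'\<close> preserves ratios of differences, so it must send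
  \<open>b\<close> to \<open>b'\<close>.\<close>

lemma line_through_similar_triples:
  fixes a u b a' u' b' :: real
  assumes "a \<noteq> u" "b \<noteq> u" "b' \<noteq> u'" "(a - u) / (b - u) = (a' - u') / (b' - u')"
    and l: "l = ((a' - u') / (a - u), u' - (a' - u') / (a - u) * u)"
  shows "fst l * a + snd l = a'" "fst l * u + snd l = u'" "fst l * b + snd l = b'"
proof -
  define s where "s = (a' - u') / (a - u)"
  have "a' - u' = s * (a - u)" using assms by (simp add: s_def)
  moreover from this have "b' - u' = s * (b - u)"
    using assms by (simp add: divide_simps)
  moreover have "l = (s, u' - s * u)" by (simp add: s_def l)
  ultimately show "fst l * a + snd l = a'" "fst l * u + snd l = u'" "fst l * b + snd l = b'"
    by (simp_all add: algebra_simps)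
qed

text \<open>A pair of similar triples amounts to an affine map \<open>l\<close> together with
  \<open>u\<close>, \<open>a\<close>, \<open>b\<close>, which \<open>l\<close> keeps inside
  \<open>B\<close>, \<open>X\<close>, \<open>Y\<close> respectively. As \<open>u\<close> lies in
  \<open>B\<close>, both \<open>a, u\<close> and \<open>b, u\<close> are pairs of distinct points,
  so \<open>l\<close> is rich for \<open>X\<close> and for \<open>Y\<close>.\<close>

lemma card_similar_triples_le:
  fixes X Y B :: "real set" and m :: nat
  assumes X: "finite X" and Y: "finite Y" and BX: "B \<subseteq> X" and BY: "B \<subseteq> Y"
    and m: "card X \<le> m" "card Y \<le> m" "1 \<le> m"
  shows "real (card {((a, u, b), (a', u', b')). a \<in> X \<and> u \<in> B \<and> b \<in> Y \<and> a \<noteq> u \<and> b \<noteq> u \<and>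
      a' \<in> X \<and> u' \<in> B \<and> b' \<in> Y \<and> a' \<noteq> u' \<and> b' \<noteq> u' \<and> (a - u) / (b - u) = (a' - u') / (b' - u')})
     \<le> 2048 * real (card B) * real m ^ 3 * (log 2 m + 1)" (is "real (card ?T) \<le> ?K")
proof -
  let ?n = "\<lambda>X l. card (line_points X X l)"
  define L where "L = rich_lines X \<inter> rich_lines Y"
  let ?S = "SIGMA l:L. line_points B B l \<times> line_points X X l \<times> line_points Y Y l"
  have finB: "finite B" using BX X by (rule finite_subset)
  have finL: "finite L" by (simp add: L_def finite_rich_lines X)
  have "card ?T \<le> card ?S"
  proof (rule card_inj_on_le)
    let ?l = "\<lambda>(a, u) (a', u'). ((a' - u') / (a - u), u' - (a' - u') / (a - u) * u)"
    let ?f = "\<lambda>((a, u, b), (a', u', b')). (?l (a, u) (a', u'), u, a, b)"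
    show "inj_on ?f ?T"
    proof (rule inj_onI)
      fix p p' assume p: "p \<in> ?T" "p' \<in> ?T" "?f p = ?f p'"
      obtain a u b a' u' b' where [simp]: "p = ((a, u, b), (a', u', b'))" by (metis surj_pair)
      obtain c v d c' v' d' where [simp]: "p' = ((c, v, d), (c', v', d'))" by (metis surj_pair)
      define l where "l = ((a' - u') / (a - u), u' - (a' - u') / (a - u) * u)"
      define l' where "l' = ((c' - v') / (c - v), v' - (c' - v') / (c - v) * v)"
      have e: "fst l * a + snd l = a'" "fst l * u + snd l = u'" "fst l * b + snd l = b'"
        by (rule line_through_similar_triples[OF _ _ _ _ l_def, of b b']; use p(1) in simp)+
      have e': "fst l' * c + snd l' = c'" "fst l' * v + snd l' = v'" "fst l' * d + snd l' = d'"
        by (rule line_through_similar_triples[OF _ _ _ _ l'_def, of d d']; use p(2) in simp)+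
      have "(l, u, a, b) = (l', v, c, d)" using p(3) by (simp only: l_def l'_def case_prod_conv \<open>p = _\<close> \<open>p' = _\<close>)
      then show "p = p'" using e e' by simp
    qed
    show "?f ` ?T \<subseteq> ?S"
    proof (rule image_subsetI)
      fix p assume p: "p \<in> ?T"
      obtain a u b a' u' b' where [simp]: "p = ((a, u, b), (a', u', b'))" by (metis surj_pair)
      define l where "l = ((a' - u') / (a - u), u' - (a' - u') / (a - u) * u)"
      have e: "fst l * a + snd l = a'" "fst l * u + snd l = u'" "fst l * b + snd l = b'"
        by (rule line_through_similar_triples[OF _ _ _ _ l_def, of b b']; use p in simp)+
      have P: "u \<in> line_points B B l" "a \<in> line_points X X l" "u \<in> line_points X X l"
        "b \<in> line_points Y Y l" "u \<in> line_points Y Y l"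
        using p e BX BY by (auto simp: line_points_def)
      have two: "2 \<le> card S" if "finite S" "x \<in> S" "y \<in> S" "x \<noteq> y" for S and x y :: real
        using card_mono[of S "{x, y}"] that by auto
      have "fst l \<noteq> 0" using p by (simp add: l_def)
      moreover have "2 \<le> card (line_points X X l)" using P X p by (intro two[of _ a u]) auto
      moreover have "2 \<le> card (line_points Y Y l)" using P Y p by (intro two[of _ b u]) auto
      ultimately have "l \<in> L" by (simp add: L_def rich_lines_def)
      then show "?f p \<in> ?S" using P by (simp add: l_def)
    qed
    show "finite ?S" using finL finB X Y by auto
  qed
  also have "card ?S = (\<Sum>l\<in>L. ?n B l * (?n X l * ?n Y l))"
    using finL finB X Y by (simp add: card_cartesian_product)
  finally have "real (card ?T) \<le> (\<Sum>l\<in>L. real (?n B l) * (real (?n X l) * real (?n Y l)))"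
    by (metis (no_types, lifting) of_nat_le_iff of_nat_mult of_nat_sum sum.cong)
  \<comment> \<open>The inequality of the means separates \<open>X\<close> from \<open>Y\<close>,
    leaving two sums over rich lines.\<close>
  also have "\<dots> \<le> (\<Sum>l\<in>L. real (?n B l) * (((real (?n X l))\<^sup>2 + (real (?n Y l))\<^sup>2) / 2))"
  proof (intro sum_mono mult_left_mono)
    fix l
    show "real (?n X l) * real (?n Y l) \<le> ((real (?n X l))\<^sup>2 + (real (?n Y l))\<^sup>2) / 2"
      using sum_squares_bound[of "real (?n X l)" "real (?n Y l)"] by simp
  qed auto
  also have "\<dots> = ((\<Sum>l\<in>L. real (?n B l) * (real (?n X l))\<^sup>2) + (\<Sum>l\<in>L. real (?n B l) * (real (?n Y l))\<^sup>2)) / 2"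
    by (simp add: sum.distrib algebra_simps add_divide_distrib sum_divide_distrib)
  also have "\<dots> \<le> ((\<Sum>l\<in>rich_lines X. real (?n B l) * (real (?n X l))\<^sup>2)
      + (\<Sum>l\<in>rich_lines Y. real (?n B l) * (real (?n Y l))\<^sup>2)) / 2"
    by (intro divide_right_mono add_mono sum_mono2) (auto simp: L_def finite_rich_lines X Y)
  also have "\<dots> \<le> (?K + ?K) / 2"
    by (intro divide_right_mono add_mono sum_rich_lines_le X Y BX BY m) auto
  finally show ?thesis by simp
qed

subsection \<open>Links\<close>

text \<open>For nonzero \<open>c\<close> this is the intersection of \<open>A\<close> with its
  dilate by \<open>c\<close>, and its size is the number of ways to write \<open>c = a / b\<close>
  with \<open>a, b\<close> nonzero elements of \<open>A\<close>, when
  \<open>0 \<notin> A\<close>.\<close>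

definition dilate_inter :: "real set \<Rightarrow> real \<Rightarrow> real set" where
  "dilate_inter A c = {a \<in> A. a / c \<in> A}"

lemma dilate_inter_subset: "dilate_inter A c \<subseteq> A"
  by (auto simp: dilate_inter_def)

lemma finite_dilate_inter [simp]: "finite A \<Longrightarrow> finite (dilate_inter A c)"
  by (simp add: dilate_inter_def)

text \<open>If \<open>a / u = b / b'\<close>, then \<open>c = a / b\<close> is a link, because
  \<open>a / c = b\<close> and \<open>u / c = b'\<close>. Thus popular ratios give pairs with many
  links.\<close>

lemma card_common_dilates_ge:
  assumes A: "finite A" and A0: "0 \<notin> A" and au: "a \<in> A" "u \<in> A"
  shows "card (dilate_inter A (a / u)) \<le> card {c \<in> ratio_set A. a \<in> dilate_inter A c \<and> u \<in> dilate_inter A c}"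
proof (rule card_inj_on_le)
  have "a \<noteq> 0" "u \<noteq> 0" using au A0 by metis+
  show "inj_on (\<lambda>b. a / b) (dilate_inter A (a / u))"
    by (rule inj_onI) (use \<open>a \<noteq> 0\<close> in \<open>auto simp: divide_cancel_left\<close>)
  show "(\<lambda>b. a / b) ` dilate_inter A (a / u) \<subseteq> {c \<in> ratio_set A. a \<in> dilate_inter A c \<and> u \<in> dilate_inter A c}"
  proof (rule image_subsetI)
    fix b assume "b \<in> dilate_inter A (a / u)"
    then have b: "b \<in> A" "b / (a / u) \<in> A" by (auto simp: dilate_inter_def)
    then have "b \<noteq> 0" using A0 by metis
    then have "a / (a / b) = b" "u / (a / b) = b / (a / u)" using \<open>a \<noteq> 0\<close> by (auto simp: field_simps)
    moreover have "a / b \<in> ratio_set A" using au b \<open>b \<noteq> 0\<close> by (auto simp: ratio_set_def)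
    ultimately show "a / b \<in> {c \<in> ratio_set A. a \<in> dilate_inter A c \<and> u \<in> dilate_inter A c}"
      using au b unfolding dilate_inter_def by (simp only: mem_Collect_eq)
  qed
  show "finite {c \<in> ratio_set A. a \<in> dilate_inter A c \<and> u \<in> dilate_inter A c}"
    using finite_ratio_set[OF A] by simp
qed

text \<open>A pair represents its own ratio, and each unpopular ratio has at most \<open>k\<close>
  representations.\<close>

lemma card_unpopular_pairs_le:
  assumes A: "finite A" and A0: "0 \<notin> A"
  shows "card {(a, u) \<in> A \<times> A. card (dilate_inter A (a / u)) \<le> k} \<le> card (ratio_set A) * k"
proof -
  define U where "U = {c \<in> ratio_set A. card (dilate_inter A c) \<le> k}"
  have finU: "finite U" using finite_ratio_set[OF A] by (simp add: U_def)
  have "card {(a, u) \<in> A \<times> A. card (dilate_inter A (a / u)) \<le> k} \<le> card (SIGMA c:U. dilate_inter A c)"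
  proof (rule card_inj_on_le)
    let ?f = "\<lambda>(a, u). (a / u, a)"
    show "inj_on ?f {(a, u) \<in> A \<times> A. card (dilate_inter A (a / u)) \<le> k}"
      by (rule inj_onI) (use A0 in \<open>auto simp: divide_cancel_left\<close>)
    show "?f ` {(a, u) \<in> A \<times> A. card (dilate_inter A (a / u)) \<le> k} \<subseteq> (SIGMA c:U. dilate_inter A c)"
    proof (rule image_subsetI)
      fix p assume p: "p \<in> {(a, u) \<in> A \<times> A. card (dilate_inter A (a / u)) \<le> k}"
      obtain a u where [simp]: "p = (a, u)" by (metis surj_pair)
      have "a \<in> A" "u \<in> A" "card (dilate_inter A (a / u)) \<le> k" using p by auto
      moreover from this have "a \<noteq> 0" "u \<noteq> 0" using A0 by metis+
      ultimately show "?f p \<in> (SIGMA c:U. dilate_inter A c)"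
        by (auto simp: U_def dilate_inter_def ratio_set_def)
    qed
    show "finite (SIGMA c:U. dilate_inter A c)" using finU A by auto
  qed
  also have "\<dots> = (\<Sum>c\<in>U. card (dilate_inter A c))" using finU A by simp
  also have "\<dots> \<le> card U * k" using sum_bounded_above[of U "\<lambda>c. card (dilate_inter A c)" k] by (simp add: U_def)
  also have "\<dots> \<le> card (ratio_set A) * k"
    by (intro mult_right_mono card_mono finite_ratio_set A) (auto simp: U_def)
  finally show ?thesis .
qed

text \<open>Pairs with unpopular ratio and diagonal pairs leave at least a quarter of all pairs,
  each with at least \<open>k\<close> links. Keeping exactly \<open>k\<close> links per pair also
  provides the upper bound on fibres that controls collisions of \<open>diffs\<close>.\<close>

lemma obtain_links:
  assumes A: "finite A" and A0: "0 \<notin> A" and n: "2 \<le> card A"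
  obtains S k where
    "finite S" "1 \<le> k" "(real (card A))\<^sup>2 / (4 * card (ratio_set A)) \<le> k"
    "\<And>a u c. (a, u, c) \<in> S \<Longrightarrow> a \<noteq> u \<and> c \<in> ratio_set A \<and> a \<in> dilate_inter A c \<and> u \<in> dilate_inter A c"
    "\<And>a u. card {c. (a, u, c) \<in> S} \<le> k"
    "(real (card A))\<^sup>2 * k / 4 \<le> card S"
proof -
  define x where "x = (real (card A))\<^sup>2 / (4 * card (ratio_set A))"
  \<comment> \<open>Rounding up makes \<open>k\<close> positive, while \<open>k - 1 \<le> x\<close>
    still limits the unpopular pairs to \<open>(card A)\<^sup>2 / 4\<close>.\<close>
  define k where "k = nat \<lceil>x\<rceil>"
  have q: "0 < card (ratio_set A)" using card_le_card_ratio_set[OF A A0] n by linarith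
  then have x0: "0 < x" using n by (simp add: x_def)
  have k1: "1 \<le> k" "x \<le> k" "real (k - 1) \<le> x" unfolding k_def using x0 by linarith+
  define C where "C a u = {c \<in> ratio_set A. a \<in> dilate_inter A c \<and> u \<in> dilate_inter A c}" for a u
  have finC: "finite (C a u)" for a u using finite_ratio_set[OF A] by (simp add: C_def)
  define G where "G = {(a, u) \<in> A \<times> A. a \<noteq> u \<and> k \<le> card (dilate_inter A (a / u))}"
  have finG: "finite G" by (rule finite_subset[of _ "A \<times> A"]) (use A in \<open>auto simp: G_def\<close>)
  define U where "U = {(a, u) \<in> A \<times> A. card (dilate_inter A (a / u)) \<le> k - 1}"
  have finU: "finite U" by (rule finite_subset[of _ "A \<times> A"]) (use A in \<open>auto simp: U_def\<close>)
  have "A \<times> A \<subseteq> G \<union> U \<union> (\<lambda>a. (a, a)) ` A"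
    using k1(1) by (auto simp: G_def U_def)
  then have "card (A \<times> A) \<le> card (G \<union> U \<union> (\<lambda>a. (a, a)) ` A)"
    by (rule card_mono[rotated]) (use finG finU A in auto)
  also have "\<dots> \<le> card G + card U + card ((\<lambda>a. (a, a)) ` A)"
    by (intro order_trans[OF card_Un_le] add_mono card_Un_le order_refl)
  also have "\<dots> \<le> card G + card (ratio_set A) * (k - 1) + card A"
    unfolding U_def by (intro add_mono order_refl card_unpopular_pairs_le[OF A A0] card_image_le A)
  finally have "real (card (A \<times> A)) \<le> real (card G + card (ratio_set A) * (k - 1) + card A)"
    by (simp only: of_nat_le_iff)
  then have "(real (card A))\<^sup>2 \<le> card G + card (ratio_set A) * real (k - 1) + card A"
    by (simp add: card_cartesian_product power2_eq_square)
  also have "card (ratio_set A) * real (k - 1) \<le> card (ratio_set A) * x" by (intro mult_left_mono k1) auto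
  also have "card (ratio_set A) * x = (real (card A))\<^sup>2 / 4" using q by (simp add: x_def)
  finally have "(real (card A))\<^sup>2 \<le> card G + (real (card A))\<^sup>2 / 4 + card A" by simp
  \<comment> \<open>The diagonal takes at most half of all pairs.\<close>
  moreover have "2 * real (card A) \<le> (real (card A))\<^sup>2" using n by (simp add: power2_eq_square)
  ultimately have cG: "(real (card A))\<^sup>2 / 4 \<le> card G" by linarith
  have "\<exists>K \<subseteq> C (fst p) (snd p). card K = k" if "p \<in> G" for p
  proof -
    have "card (dilate_inter A (fst p / snd p)) \<le> card (C (fst p) (snd p))"
      unfolding C_def by (rule card_common_dilates_ge[OF A A0]) (use that in \<open>auto simp: G_def\<close>)
    then have "k \<le> card (C (fst p) (snd p))" using that by (auto simp: G_def)
    then show ?thesis by (metis obtain_subset_with_card_n)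
  qed
  then obtain K where K: "\<And>p. p \<in> G \<Longrightarrow> K p \<subseteq> C (fst p) (snd p) \<and> card (K p) = k" by metis
  have finK: "finite (K p)" if "p \<in> G" for p using K[OF that] finC by (metis finite_subset)
  define S where "S = (\<lambda>((a, u), c). (a, u, c)) ` (SIGMA p:G. K p)"
  have mem: "(a, u, c) \<in> S \<longleftrightarrow> (a, u) \<in> G \<and> c \<in> K (a, u)" for a u c by (force simp: S_def)
  have "card S = card (SIGMA p:G. K p)" unfolding S_def by (rule card_image) (auto simp: inj_on_def)
  also have "\<dots> = (\<Sum>p\<in>G. card (K p))" using finG finK by simp
  also have "\<dots> = card G * k" using K by simp
  finally have "real (card S) = card G * real k" by simp
  then have cS: "(real (card A))\<^sup>2 * k / 4 \<le> card S"
    using mult_right_mono[OF cG, of "real k"] by simp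
  show ?thesis
  proof (rule that[of S k])
    show "finite S" unfolding S_def using finG finK by auto
    show "(real (card A))\<^sup>2 / (4 * card (ratio_set A)) \<le> k" using k1 by (simp add: x_def)
    show "a \<noteq> u \<and> c \<in> ratio_set A \<and> a \<in> dilate_inter A c \<and> u \<in> dilate_inter A c" if "(a, u, c) \<in> S" for a u c
      using that K[of "(a, u)"] by (auto simp: mem C_def G_def)
    show "card {c. (a, u, c) \<in> S} \<le> k" for a u
      using K[of "(a, u)"] by (cases "(a, u) \<in> G") (auto simp: mem)
  qed (use k1 cS in auto)
qed

subsection \<open>Configurations and their lines\<close>

text \<open>The situation once the links have been restricted to one dyadic level;
  \<open>2 ^ j\<close> is the \<open>\<Delta>\<close> of the overview.\<close>

locale links =
  fixes A :: "real set" and S :: "(real \<times> real \<times> real) set" and k j :: nat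
  assumes A: "finite A" and A0: "0 \<notin> A" and n1: "1 \<le> card A" and S: "finite S"
    and link: "\<And>a u c. (a, u, c) \<in> S \<Longrightarrow>
      a \<noteq> u \<and> c \<in> ratio_set A \<and> a \<in> dilate_inter A c \<and> u \<in> dilate_inter A c"
    and level: "\<And>a u c. (a, u, c) \<in> S \<Longrightarrow>
      2 ^ j \<le> card (dilate_inter A c) \<and> card (dilate_inter A c) < 2 ^ Suc j"
    and fibre: "\<And>a u. card {c. (a, u, c) \<in> S} \<le> k"
begin

definition "n \<equiv> real (card A)"
definition "q \<equiv> real (card (ratio_set A))"
definition "H \<equiv> log 2 (card A) + 1"
definition "dilations = {c \<in> ratio_set A. 2 ^ j \<le> card (dilate_inter A c) \<and> card (dilate_inter A c) < 2 ^ Suc j}"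
definition "T = {((a, u, b), (c, d)) | a u b c d. (a, u, c) \<in> S \<and> (b, u, d) \<in> S}"

text \<open>Forgets a common translation of \<open>a, u, b\<close>; the number of its values is
  \<open>J\<close>.\<close>

fun diffs :: "(real \<times> real \<times> real) \<times> (real \<times> real) \<Rightarrow> (real \<times> real) \<times> (real \<times> real)" where
  "diffs ((a, u, b), p) = ((a - u, b - u), p)"

text \<open>Forgets in addition a common scaling of the two differences; the number of its values is
  \<open>I\<close>.\<close>

fun key :: "(real \<times> real \<times> real) \<times> (real \<times> real) \<Rightarrow> real \<times> real \<times> real" where
  "key ((a, u, b), p) = ((a - u) / (b - u), p)"

text \<open>
  For \<open>\<rho> = x / y\<close>, this is the line \<open>(x / c) X - (y / d) Y = x - y\<close>, which passes through the point
  \<open>(c, d)\<close>; its coefficients are differences of elements of \<open>A\<close>.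
\<close>

fun key_line :: "real \<times> real \<times> real \<Rightarrow> real \<times> real" where
  "key_line (r, c, d) = (r * d / c, (1 - r) * d)"

text \<open>The pairs \<open>(x, y)\<close> behind one incidence; their number is the
  \<open>w\<close> of the overview. They range over all of \<open>T\<close>, so the count is
  unaffected by passing to a subset.\<close>

definition "reps \<kappa> = (\<lambda>t. fst (diffs t)) ` {t \<in> T. key t = \<kappa>}"

section \<open>Size and collisions of the configurations\<close>

lemma zero_notin_ratio_set: "0 \<notin> ratio_set A"
  using A0 by (auto simp: ratio_set_def)

lemma finite_dilations: "finite dilations"
  using finite_ratio_set[OF A] by (simp add: dilations_def)

lemma T_D:
  assumes "((a, u, b), (c, d)) \<in> T"
  shows "(a, u, c) \<in> S" "(b, u, d) \<in> S" "a \<in> A" "u \<in> A" "b \<in> A" "a \<noteq> u" "b \<noteq> u"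
    "a / c \<in> A" "u / c \<in> A" "u / d \<in> A" "b / d \<in> A"
    "c \<in> dilations" "d \<in> dilations" "c \<noteq> 0" "d \<noteq> 0"
proof -
  have S: "(a, u, c) \<in> S" "(b, u, d) \<in> S" using assms by (auto simp: T_def)
  then show "(a, u, c) \<in> S" "(b, u, d) \<in> S" "a \<in> A" "u \<in> A" "b \<in> A" "a \<noteq> u" "b \<noteq> u"
    "a / c \<in> A" "u / c \<in> A" "u / d \<in> A" "b / d \<in> A" "c \<in> dilations" "d \<in> dilations"
    using link level by (auto simp: dilate_inter_def dilations_def)
  then show "c \<noteq> 0" "d \<noteq> 0" using zero_notin_ratio_set by (auto simp: dilations_def)
qed

lemma finite_T: "finite T"
proof (rule finite_subset)
  show "T \<subseteq> (A \<times> A \<times> A) \<times> (dilations \<times> dilations)"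
  proof
    fix t assume "t \<in> T"
    moreover obtain a u b c d where "t = ((a, u, b), (c, d))" by (metis surj_pair)
    ultimately show "t \<in> (A \<times> A \<times> A) \<times> (dilations \<times> dilations)" using T_D by simp
  qed
qed (use A finite_dilations in auto)

text \<open>The pair \<open>(a, a / c)\<close> determines \<open>c\<close>, so the sets
  \<open>dilate_inter A c\<close> have total size at most \<open>n\<^sup>2\<close>. Each dilation of
  the level carries at most \<open>(2 * 2 ^ j)\<^sup>2\<close> links.\<close>

lemma card_links_le: "card S \<le> 4 * 2 ^ j * n\<^sup>2"
  and card_dilations_le: "card dilations * 2 ^ j \<le> n\<^sup>2"
proof -
  have "(\<Sum>c\<in>dilations. card (dilate_inter A c)) = card (SIGMA c:dilations. dilate_inter A c)"
    using A finite_dilations by simp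
  also have "\<dots> \<le> card (A \<times> A)"
  proof (rule card_inj_on_le)
    let ?f = "\<lambda>(c, a). (a, a / c)"
    show "inj_on ?f (SIGMA c:dilations. dilate_inter A c)"
      by (rule inj_onI)
        (use A0 in \<open>auto simp: dilate_inter_def divide_cancel_left\<close>)
    show "?f ` (SIGMA c:dilations. dilate_inter A c) \<subseteq> A \<times> A" by (auto simp: dilate_inter_def)
  qed (use A in auto)
  finally have "(\<Sum>c\<in>dilations. card (dilate_inter A c)) \<le> card A * card A" by (simp add: card_cartesian_product)
  moreover have "card dilations * 2 ^ j \<le> (\<Sum>c\<in>dilations. card (dilate_inter A c))"
    using sum_bounded_below[of dilations "2 ^ j" "\<lambda>c. card (dilate_inter A c)"] by (simp add: dilations_def)
  ultimately have "real (card dilations * 2 ^ j) \<le> real (card A * card A)" by (simp only: of_nat_le_iff)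
  then show *: "card dilations * 2 ^ j \<le> n\<^sup>2" by (simp add: n_def power2_eq_square)
  have "card S \<le> card (SIGMA c:dilations. dilate_inter A c \<times> dilate_inter A c)"
  proof (rule card_inj_on_le)
    let ?f = "\<lambda>(a, u, c). (c, a, u)"
    show "inj_on ?f S" by (rule inj_onI) auto
    show "?f ` S \<subseteq> (SIGMA c:dilations. dilate_inter A c \<times> dilate_inter A c)"
      using link level by (force simp: dilations_def)
  qed (use A finite_dilations in auto)
  also have "\<dots> = (\<Sum>c\<in>dilations. card (dilate_inter A c) * card (dilate_inter A c))"
    using A finite_dilations by (simp add: card_cartesian_product)
  also have "\<dots> \<le> card dilations * ((2 * 2 ^ j) * (2 * 2 ^ j))"
  proof -
    have "card (dilate_inter A c) * card (dilate_inter A c) \<le> (2 * 2 ^ j) * (2 * 2 ^ j)" if "c \<in> dilations" for c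
      by (rule mult_le_mono) (use that in \<open>auto simp: dilations_def\<close>)
    then have "(\<Sum>c\<in>dilations. card (dilate_inter A c) * card (dilate_inter A c))
        \<le> of_nat (card dilations) * ((2 * 2 ^ j) * (2 * 2 ^ j))"
      by (rule sum_bounded_above)
    then show ?thesis by (simp only: of_nat_id)
  qed
  finally have "real (card S) \<le> real (card dilations * ((2 * 2 ^ j) * (2 * 2 ^ j)))" by (simp only: of_nat_le_iff)
  also have "\<dots> = real (card dilations * 2 ^ j) * (4 * 2 ^ j)" by simp
  also have "\<dots> \<le> n\<^sup>2 * (4 * 2 ^ j)" using * by (intro mult_right_mono) auto
  finally show "card S \<le> 4 * 2 ^ j * n\<^sup>2" by (simp add: algebra_simps)
qed

text \<open>Cauchy-Schwarz over the shared element \<open>u\<close>, which takes at most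
  \<open>n\<close> values: two links with the same \<open>u\<close> form a configuration.\<close>

lemma card_T_ge: "(real (card S))\<^sup>2 \<le> card T * n"
proof -
  let ?f = "\<lambda>(a :: real, u :: real, c :: real). u"
  have "card {(s, t). s \<in> S \<and> t \<in> S \<and> ?f s = ?f t} \<le> card T"
  proof (rule card_inj_on_le)
    let ?g = "\<lambda>((a, u, c), (b, v :: real, d)). ((a, u, b), (c, d))"
    show "inj_on ?g {(s, t). s \<in> S \<and> t \<in> S \<and> ?f s = ?f t}" by (rule inj_onI) auto
    show "?g ` {(s, t). s \<in> S \<and> t \<in> S \<and> ?f s = ?f t} \<subseteq> T" by (auto simp: T_def)
  qed (rule finite_T)
  moreover have "card (?f ` S) \<le> card A"
  proof (rule card_mono[OF A], rule image_subsetI)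
    fix s assume "s \<in> S"
    moreover obtain a u c where "s = (a, u, c)" by (metis prod_cases3)
    ultimately show "?f s \<in> A" using link by (auto simp: dilate_inter_def)
  qed
  ultimately have "(card S)\<^sup>2 \<le> card A * card T"
    using card_square_le_collisions[OF S, of ?f] by (meson mult_le_mono order_trans)
  then have "real ((card S)\<^sup>2) \<le> real (card A * card T)" by (simp only: of_nat_le_iff)
  then show ?thesis by (simp add: n_def mult.commute)
qed

lemma H_ge_1: "1 \<le> H"
  using n1 by (simp add: H_def)

lemma sum_card_inter_dilates_le:
  "real (\<Sum>(c, d)\<in>dilations \<times> dilations. card (dilate_inter A c \<inter> dilate_inter A d)) \<le> n ^ 3"
proof -
  let ?B = "\<lambda>p. dilate_inter A (fst p) \<inter> dilate_inter A (snd p)"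
  have "(\<Sum>p\<in>dilations \<times> dilations. card (?B p)) = card (SIGMA p:dilations \<times> dilations. ?B p)"
    using A finite_dilations by simp
  also have "\<dots> \<le> card (A \<times> A \<times> A)"
  proof (rule card_inj_on_le)
    let ?f = "\<lambda>((c, d), u). (u, u / c, u / d)"
    show "inj_on ?f (SIGMA p:dilations \<times> dilations. ?B p)"
      by (rule inj_onI)
        (use A0 in \<open>auto simp: dilate_inter_def divide_cancel_left\<close>)
    show "?f ` (SIGMA p:dilations \<times> dilations. ?B p) \<subseteq> A \<times> A \<times> A" by (auto simp: dilate_inter_def)
  qed (use A in auto)
  finally have "(\<Sum>p\<in>dilations \<times> dilations. card (?B p)) \<le> card A * (card A * card A)"
    by (simp add: card_cartesian_product)
  then have "real (\<Sum>p\<in>dilations \<times> dilations. card (?B p)) \<le> real (card A * (card A * card A))"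
    by (simp only: of_nat_le_iff)
  then show ?thesis by (simp add: n_def power3_eq_cube case_prod_unfold)
qed

text \<open>For fixed \<open>(c, d)\<close>, configurations with equal key are pairs of similar
  triples in the dilates. The bound for these is linear in the size of the intersection of the two
  dilates, whose sum over \<open>(c, d)\<close> is at most \<open>n ^ 3\<close>.\<close>

lemma card_keys_ge:
  assumes T': "T' \<subseteq> T"
  shows "(real (card T'))\<^sup>2 \<le> card (key ` T') * (2 ^ 15 * (2 ^ j) ^ 3 * n ^ 3 * H)"
proof (cases "T' = {}")
  case False
  \<comment> \<open>A configuration exhibits a dilate of size at least \<open>2 ^ j\<close>, so
    \<open>2 ^ j \<le> card A\<close> and the logarithm at scale \<open>2 ^ Suc j\<close> is within
    \<open>2 * H\<close>.\<close>
  then obtain t where "t \<in> T" using T' by blast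
  then obtain a u c where "(a, u, c) \<in> S" by (auto simp: T_def)
  then have "(2 :: nat) ^ j \<le> card (dilate_inter A c)" using level by simp
  also have "\<dots> \<le> card A" using A dilate_inter_subset by (intro card_mono) auto
  finally have jn: "(2 :: nat) ^ j \<le> card A" .
  define m :: nat where "m = 2 ^ Suc j"
  have "real m \<le> real (2 * card A)" using jn by (simp only: of_nat_le_iff m_def power_Suc)
  then have "log 2 m \<le> log 2 (2 * real (card A))" by (subst log_le_cancel_iff) (use n1 in \<open>auto simp: m_def\<close>)
  also have "\<dots> = 1 + log 2 (card A)" using n1 by (subst log_mult) auto
  finally have Hm: "log 2 m + 1 \<le> 2 * H" using H_ge_1 unfolding H_def by simp
  define R where "R X Y B = {((a, u, b), (a', u', b')). a \<in> X \<and> u \<in> B \<and> b \<in> Y \<and> a \<noteq> u \<and> b \<noteq> u \<and>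
      a' \<in> X \<and> u' \<in> B \<and> b' \<in> Y \<and> a' \<noteq> u' \<and> b' \<noteq> u' \<and> (a - u) / (b - u) = (a' - u') / (b' - u')}"
    for X Y B :: "real set"
  let ?B = "\<lambda>c d. dilate_inter A c \<inter> dilate_inter A d"
  let ?R = "\<lambda>(c, d). R (dilate_inter A c) (dilate_inter A d) (?B c d)"
  have finR: "finite (?R p)" for p
    by (rule finite_subset[of _ "(A \<times> A \<times> A) \<times> (A \<times> A \<times> A)"])
      (use A in \<open>auto simp: R_def dilate_inter_def case_prod_unfold\<close>)
  have Rle: "real (card (?R (c, d))) \<le> card (?B c d) * (2 ^ 15 * (2 ^ j) ^ 3 * H)"
    if "c \<in> dilations" "d \<in> dilations" for c d
  proof -
    have "real (card (?R (c, d))) \<le> 2048 * real (card (?B c d)) * real m ^ 3 * (log 2 m + 1)"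
      unfolding R_def prod.case
      by (rule card_similar_triples_le) (use A that in \<open>auto simp: m_def dilations_def\<close>)
    also have "\<dots> \<le> 2048 * real (card (?B c d)) * real m ^ 3 * (2 * H)"
      using Hm by (intro mult_left_mono) auto
    also have "\<dots> = card (?B c d) * (2 ^ 15 * (2 ^ j) ^ 3 * H)"
      by (simp add: m_def power_mult_distrib)
    finally show ?thesis .
  qed
  have "card {(s, t). s \<in> T' \<and> t \<in> T' \<and> key s = key t} \<le> card (SIGMA p:dilations \<times> dilations. ?R p)"
  proof (rule card_inj_on_le)
    let ?f = "\<lambda>(s, t). (snd s, fst s, fst t)"
    show "inj_on ?f {(s, t). s \<in> T' \<and> t \<in> T' \<and> key s = key t}"
      by (rule inj_onI) auto
    show "?f ` {(s, t). s \<in> T' \<and> t \<in> T' \<and> key s = key t} \<subseteq> (SIGMA p:dilations \<times> dilations. ?R p)"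
    proof (rule image_subsetI)
      fix p assume p: "p \<in> {(s, t). s \<in> T' \<and> t \<in> T' \<and> key s = key t}"
      obtain a u b c d a' u' b' c' d' where [simp]: "p = (((a, u, b), (c, d)), ((a', u', b'), (c', d')))"
        by (metis surj_pair)
      have t: "((a, u, b), (c, d)) \<in> T" "((a', u', b'), (c', d')) \<in> T" using p T' by auto
      show "?f p \<in> (SIGMA p:dilations \<times> dilations. ?R p)"
        using p T_D[OF t(1)] T_D[OF t(2)] by (simp add: R_def dilate_inter_def)
    qed
    show "finite (SIGMA p:dilations \<times> dilations. ?R p)" using finite_dilations finR by blast
  qed
  also have "card (SIGMA p:dilations \<times> dilations. ?R p) = (\<Sum>p\<in>dilations \<times> dilations. card (?R p))"
    using finite_dilations finR by simp
  finally have "real (card {(s, t). s \<in> T' \<and> t \<in> T' \<and> key s = key t})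
     \<le> real (\<Sum>p\<in>dilations \<times> dilations. card (?R p))"
    by (simp only: of_nat_le_iff)
  also have "\<dots> = (\<Sum>p\<in>dilations \<times> dilations. real (card (?R p)))" by simp
  also have "\<dots> \<le> (\<Sum>p\<in>dilations \<times> dilations. card (?B (fst p) (snd p)) * (2 ^ 15 * (2 ^ j) ^ 3 * H))"
    by (rule sum_mono) (use Rle in auto)
  also have "\<dots> = real (\<Sum>(c, d)\<in>dilations \<times> dilations. card (?B c d)) * (2 ^ 15 * (2 ^ j) ^ 3 * H)"
    by (simp add: case_prod_unfold sum_distrib_right)
  also have "\<dots> \<le> n ^ 3 * (2 ^ 15 * (2 ^ j) ^ 3 * H)"
    using H_ge_1 by (intro mult_right_mono sum_card_inter_dilates_le) auto
  finally have c: "real (card {(s, t). s \<in> T' \<and> t \<in> T' \<and> key s = key t}) \<le> n ^ 3 * (2 ^ 15 * (2 ^ j) ^ 3 * H)" .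
  have "finite T'" using T' finite_T by (rule finite_subset)
  then have "real ((card T')\<^sup>2) \<le> real (card (key ` T') * card {(s, t). s \<in> T' \<and> t \<in> T' \<and> key s = key t})"
    using card_square_le_collisions[of T' key] by (simp only: of_nat_le_iff)
  also have "\<dots> \<le> card (key ` T') * (n ^ 3 * (2 ^ 15 * (2 ^ j) ^ 3 * H))"
    unfolding of_nat_mult by (intro mult_left_mono c) auto
  finally show ?thesis by (simp add: mult_ac)
qed simp

text \<open>Configurations with equal \<open>diffs\<close> are translates by some \<open>d\<close>,
  so \<open>a, u, b\<close> are three elements of \<open>A\<close> that stay in \<open>A\<close>
  after subtracting \<open>d\<close>: this is the third moment. Each such triple carries at most
  \<open>k\<close> choices for either link.\<close>

lemma card_diffs_ge:
  assumes T': "T' \<subseteq> T"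
  shows "(real (card T'))\<^sup>2 \<le> card (diffs ` T') * (real k ^ 2 * (4096 * q\<^sup>2 * n * H))"
proof -
  let ?R = "\<lambda>d. {a \<in> A. a - d \<in> A}"
  let ?K = "\<lambda>a u. {c. (a, u, c) \<in> S}"
  define D where "D = difference_set A"
  have finD: "finite D" using finite_difference_set[OF A] by (simp add: D_def)
  have finK: "finite (?K a u)" for a u
    by (rule finite_subset[of _ "(\<lambda>(a, u, c). c) ` S"]) (use S in force)+
  let ?E = "SIGMA d:D. ?R d \<times> ?R d \<times> ?R d"
  have finE: "finite ?E" using finD A by auto
  have "card {(s, t). s \<in> T' \<and> t \<in> T' \<and> diffs s = diffs t}
     \<le> card (SIGMA (d, a, u, b):?E. ?K a u \<times> ?K b u)"
  proof (rule card_inj_on_le)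
    let ?f = "\<lambda>(((a, u, b), p), ((a', u', b'), p')). ((u - u', a, u, b), p)"
    have mem: "?f p \<in> (SIGMA (d, a, u, b):?E. ?K a u \<times> ?K b u)"
      and inv: "p = (case ?f p of ((d, a, u, b), p) \<Rightarrow> (((a, u, b), p), ((a - d, u - d, b - d), p)))"
      if p: "p \<in> {(s, t). s \<in> T' \<and> t \<in> T' \<and> diffs s = diffs t}" for p
    proof -
      obtain a u b c d a' u' b' c' d' where [simp]: "p = (((a, u, b), (c, d)), ((a', u', b'), (c', d')))"
        by (metis surj_pair)
      have t: "((a, u, b), (c, d)) \<in> T" "((a', u', b'), (c', d')) \<in> T" using p T' by auto
      have e: "a - (u - u') = a'" "b - (u - u') = b'" "c = c'" "d = d'" using p by auto
      show "?f p \<in> (SIGMA (d, a, u, b):?E. ?K a u \<times> ?K b u)"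
        using e T_D[OF t(1)] T_D[OF t(2)] by (auto simp: D_def difference_set_def)
      show "p = (case ?f p of ((d, a, u, b), p) \<Rightarrow> (((a, u, b), p), ((a - d, u - d, b - d), p)))"
        using e by simp
    qed
    show "inj_on ?f {(s, t). s \<in> T' \<and> t \<in> T' \<and> diffs s = diffs t}"
    proof (rule inj_onI)
      fix p p' assume a: "p \<in> {(s, t). s \<in> T' \<and> t \<in> T' \<and> diffs s = diffs t}"
        "p' \<in> {(s, t). s \<in> T' \<and> t \<in> T' \<and> diffs s = diffs t}" "?f p = ?f p'"
      show "p = p'" using inv[OF a(1)] inv[OF a(2)] unfolding a(3) by (rule trans[OF _ sym])
    qed
    show "?f ` {(s, t). s \<in> T' \<and> t \<in> T' \<and> diffs s = diffs t} \<subseteq> (SIGMA (d, a, u, b):?E. ?K a u \<times> ?K b u)"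
      using mem by (rule image_subsetI)
    show "finite (SIGMA (d, a, u, b):?E. ?K a u \<times> ?K b u)"
      by (rule finite_SigmaI[OF finE]) (use finK in \<open>auto split: prod.splits\<close>)
  qed
  also have "\<dots> = (\<Sum>(d, a, u, b)\<in>?E. card (?K a u) * card (?K b u))"
    using finE finK by (subst card_SigmaI) (auto simp: card_cartesian_product intro!: sum.cong)
  also have "\<dots> \<le> (\<Sum>p\<in>?E. k * k)"
    by (rule sum_mono) (auto intro!: mult_mono fibre)
  also have "\<dots> = card ?E * (k * k)" by simp
  also have "card ?E = (\<Sum>d\<in>D. card (?R d) ^ 3)"
    using finD A by (simp add: card_cartesian_product power3_eq_cube mult.assoc)
  finally have "real (card {(s, t). s \<in> T' \<and> t \<in> T' \<and> diffs s = diffs t})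
     \<le> real ((\<Sum>d\<in>D. card (?R d) ^ 3) * (k * k))" by (simp only: of_nat_le_iff)
  also have "\<dots> = (\<Sum>d\<in>D. real (card (?R d)) ^ 3) * (real k)\<^sup>2" by (simp add: power2_eq_square)
  also have "\<dots> \<le> (4096 * q\<^sup>2 * n * H) * (real k)\<^sup>2"
    using third_energy_le[OF A A0 n1] by (intro mult_right_mono) (auto simp: q_def n_def H_def D_def)
  finally have c: "real (card {(s, t). s \<in> T' \<and> t \<in> T' \<and> diffs s = diffs t}) \<le> real k ^ 2 * (4096 * q\<^sup>2 * n * H)"
    by (simp add: mult.commute)
  have "finite T'" using T' finite_T by (rule finite_subset)
  then have "real ((card T')\<^sup>2) \<le> real (card (diffs ` T') * card {(s, t). s \<in> T' \<and> t \<in> T' \<and> diffs s = diffs t})"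
    using card_square_le_collisions[of T' diffs] by (simp only: of_nat_le_iff)
  also have "\<dots> \<le> card (diffs ` T') * (real k ^ 2 * (4096 * q\<^sup>2 * n * H))"
    unfolding of_nat_mult by (intro mult_left_mono c) auto
  finally show ?thesis by simp
qed

section \<open>Multiplicities of lines and incidences\<close>

lemma finite_reps: "finite (reps \<kappa>)"
  using finite_T by (simp add: reps_def)

text \<open>Each \<open>(x, y)\<close> behind an incidence at \<open>(c, d)\<close> writes its line
  with the coefficients \<open>x / c\<close>, \<open>y / d\<close>, \<open>x - y\<close>, all
  differences of elements of \<open>A\<close>. Different \<open>(x, y)\<close> give different
  triples, and a triple determines the line.\<close>

lemma key_lines_bound:
  fixes \<omega> :: real
  assumes T': "T' \<subseteq> T" and w: "\<And>t. t \<in> T' \<Longrightarrow> \<omega> \<le> card (reps (key t))"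
  shows "\<omega> * card (key_line ` key ` T') \<le> real (card (difference_set A)) ^ 3"
proof -
  define D where "D = difference_set A"
  have finD: "finite D" using finite_difference_set[OF A] by (simp add: D_def)
  have finT': "finite T'" using T' finite_T by (rule finite_subset)
  define L where "L = key_line ` key ` T'"
  have finL: "finite L" using finT' by (simp add: L_def)
  \<comment> \<open>The triples for which \<open>l\<close> is the line
    \<open>x * X - y * Y = z\<close>, solved for \<open>Y\<close>.\<close>
  define R where "R l = {(x, y, z) \<in> D \<times> D \<times> D. y \<noteq> 0 \<and> l = (x / y, - z / y)}" for l
  have finR: "finite (R l)" for l
    by (rule finite_subset[of _ "D \<times> D \<times> D"]) (use finD in \<open>auto simp: R_def\<close>)
  have "\<omega> \<le> card (R l)" if l: "l \<in> L" for l
  proof -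
    obtain t where t: "t \<in> T'" "l = key_line (key t)" using l unfolding L_def by (metis imageE)
    obtain a0 u0 b0 c d where t0: "t = ((a0, u0, b0), (c, d))" by (metis surj_pair)
    have "((a0, u0, b0), (c, d)) \<in> T" using t(1) T' unfolding t0 by (rule rev_subsetD)
    then have cd: "c \<noteq> 0" "d \<noteq> 0" by (rule T_D)+
    have "card (reps (key t)) \<le> card (R l)"
    proof (rule card_inj_on_le)
      let ?f = "\<lambda>(x, y). (x / c, y / d, x - y)"
      show "inj_on ?f (reps (key t))" by (rule inj_onI) (use cd in auto)
      show "?f ` reps (key t) \<subseteq> R l"
      proof (rule image_subsetI)
        fix p assume "p \<in> reps (key t)"
        then obtain s where s: "s \<in> T" "key s = key t" "p = fst (diffs s)" unfolding reps_def by blast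
        obtain a u b c' d' where "s = ((a, u, b), (c', d'))" by (metis surj_pair)
        then have s0: "s = ((a, u, b), (c, d))" using s(2) t0 by simp
        note m = T_D[OF s(1)[unfolded s0]]
        have l: "l = ((a - u) / (b - u) * d / c, (1 - (a - u) / (b - u)) * d)"
          using t(2) s(2)[symmetric] s0 by simp
        have "(a - u) / c = a / c - u / c" "(b - u) / d = b / d - u / d" "(a - u) - (b - u) = a - b"
          by (simp_all add: diff_divide_distrib)
        then have "(a - u) / c \<in> D" "(b - u) / d \<in> D" "(a - u) - (b - u) \<in> D"
          using m unfolding D_def difference_set_def by blast+
        moreover have "(b - u) / d \<noteq> 0" using m by simp
        moreover have "l = ((a - u) / c / ((b - u) / d), - ((a - u) - (b - u)) / ((b - u) / d))"
        proof -
          have "b - u \<noteq> 0" using m by simp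
          then show ?thesis unfolding l using cd by (simp add: divide_simps)
        qed
        ultimately have "((a - u) / c, (b - u) / d, (a - u) - (b - u)) \<in> R l"
          by (simp only: R_def mem_Collect_eq case_prod_conv mem_Sigma_iff simp_thms)
        then show "?f p \<in> R l" using s(3) s0 by simp
      qed
    qed (rule finR)
    then show ?thesis using w[OF t(1)] by linarith
  qed
  then have "(\<Sum>l\<in>L. \<omega>) \<le> (\<Sum>l\<in>L. real (card (R l)))" by (rule sum_mono)
  also have "\<dots> = real (card (SIGMA l:L. R l))" using finL finR by simp
  also have "\<dots> \<le> real (card (D \<times> D \<times> D))"
  proof (subst of_nat_le_iff, rule card_inj_on_le)
    show "inj_on snd (SIGMA l:L. R l)" by (rule inj_onI) (auto simp: R_def)
    show "snd ` (SIGMA l:L. R l) \<subseteq> D \<times> D \<times> D" by (auto simp: R_def)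
  qed (use finD in auto)
  finally show ?thesis by (simp add: L_def D_def card_cartesian_product power3_eq_cube mult.commute mult.left_commute)
qed

text \<open>A key is an incidence of the point \<open>(c, d)\<close> with its line; the slope is
  nonzero because \<open>a \<noteq> u\<close>.\<close>

lemma key_incidences:
  assumes T': "T' \<subseteq> T"
  shows "real (card (key ` T')) < 8 * real (card (key_line ` key ` T')) \<or>
    real (card (key ` T')) ^ 3 \<le> 512 * real (card dilations) ^ 4 * (real (card (key_line ` key ` T')))\<^sup>2"
proof -
  define L where "L = key_line ` key ` T'"
  have finT': "finite T'" using T' finite_T by (rule finite_subset)
  have finL: "finite L" using finT' by (simp add: L_def)
  have keyD: "c \<in> dilations" "d \<in> dilations" "c \<noteq> 0" "d \<noteq> 0" "r \<noteq> 0" if "(r, c, d) \<in> key ` T'" for r c d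
  proof -
    from that obtain t where t: "(r, c, d) = key t" "t \<in> T'" by (rule imageE)
    obtain a u b c' d' where t0: "t = ((a, u, b), (c', d'))" by (metis surj_pair)
    have e: "c' = c" "d' = d" "r = (a - u) / (b - u)" using t(1) t0 by auto
    have "((a, u, b), (c, d)) \<in> T" using t(2) T' unfolding t0 e by (rule rev_subsetD)
    note T_D[OF this]
    then show "c \<in> dilations" "d \<in> dilations" "c \<noteq> 0" "d \<noteq> 0" "r \<noteq> 0"
      unfolding e(3) by simp_all
  qed
  have "card (key ` T') \<le> card (SIGMA l:L. line_points dilations dilations l)"
  proof (rule card_inj_on_le)
    let ?f = "\<lambda>(r, c, d). (key_line (r, c, d), c)"
    show "inj_on ?f (key ` T')"
    proof (rule inj_onI)
      fix p p' assume a: "p \<in> key ` T'" "p' \<in> key ` T'" "?f p = ?f p'"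
      obtain r c d r' c' d' where [simp]: "p = (r, c, d)" "p' = (r', c', d')" by (metis surj_pair)
      have nz: "c \<noteq> 0" "d \<noteq> 0" "c' \<noteq> 0" "d' \<noteq> 0" using keyD a by auto
      have e: "c = c'" "r * d / c = r' * d' / c" "(1 - r) * d = (1 - r') * d'" using a(3) by auto
      then have "r * d = r' * d'" using nz by simp
      \<comment> \<open>The intercept is \<open>d - r * d\<close>, so adding \<open>r * d\<close>
        recovers \<open>d\<close>.\<close>
      moreover from this e(3) have "d = d'" by (simp add: algebra_simps)
      ultimately show "p = p'" using e(1) nz by simp
    qed
    show "?f ` key ` T' \<subseteq> (SIGMA l:L. line_points dilations dilations l)"
    proof (rule image_subsetI)
      fix p assume p: "p \<in> key ` T'"
      obtain r c d where p0: "p = (r, c, d)" by (metis surj_pair)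
      have "key_line p \<in> L" using p by (auto simp: L_def)
      moreover have "r * d / c * c + (1 - r) * d = d" using keyD p p0 by (simp add: algebra_simps)
      ultimately show "?f p \<in> (SIGMA l:L. line_points dilations dilations l)"
        using keyD[of r c d] p p0 by (simp add: line_points_def)
    qed
    show "finite (SIGMA l:L. line_points dilations dilations l)" using finL finite_dilations by auto
  qed
  also have "\<dots> = (\<Sum>l\<in>L. card (line_points dilations dilations l))" using finL finite_dilations by simp
  finally have "real (card (key ` T')) \<le> real (\<Sum>l\<in>L. card (line_points dilations dilations l))"
    by (simp only: of_nat_le_iff)
  moreover have "fst l \<noteq> 0" if l: "l \<in> L" for l
  proof -
    obtain r c d where "(r, c, d) \<in> key ` T'" "l = key_line (r, c, d)"
      using l unfolding L_def by (metis imageE surj_pair)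
    then show ?thesis using keyD[of r c d] by simp
  qed
  ultimately have "real (card (key ` T')) < 8 * card L \<or> real (card (key ` T')) ^ 3
      \<le> 512 * (real (card dilations) * card dilations)\<^sup>2 * (real (card L))\<^sup>2"
    by (intro szemeredi_trotter_grid finite_dilations finL)
  then show ?thesis by (simp add: L_def power2_eq_square power4_eq_xxxx mult.assoc)
qed

lemma card_diffs_le:
  fixes \<omega> :: real
  assumes T': "T' \<subseteq> T" and w: "\<And>t. t \<in> T' \<Longrightarrow> card (reps (key t)) \<le> \<omega>"
  shows "card (diffs ` T') \<le> card (key ` T') * \<omega>"
proof -
  have finT': "finite T'" using T' finite_T by (rule finite_subset)
  have "card (diffs ` T') \<le> card (SIGMA \<kappa>:key ` T'. reps \<kappa>)"
  proof (rule card_inj_on_le)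
    let ?f = "\<lambda>((x, y), p). ((x / y, p), (x, y))"
    show "inj_on ?f (diffs ` T')" by (rule inj_onI) auto
    show "?f ` diffs ` T' \<subseteq> (SIGMA \<kappa>:key ` T'. reps \<kappa>)"
    proof (rule image_subsetI)
      fix e assume "e \<in> diffs ` T'"
      then obtain t where t: "t \<in> T'" "e = diffs t" by (metis imageE)
      obtain a u b p where t0: "t = ((a, u, b), p)" by (metis surj_pair)
      have "fst (diffs t) \<in> reps (key t)" using t T' unfolding reps_def by blast
      moreover have "?f e = (key t, fst (diffs t))" using t t0 by simp
      ultimately show "?f e \<in> (SIGMA \<kappa>:key ` T'. reps \<kappa>)" using t(1) by simp
    qed
    show "finite (SIGMA \<kappa>:key ` T'. reps \<kappa>)" using finT' finite_reps by auto
  qed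
  also have "\<dots> = (\<Sum>\<kappa>\<in>key ` T'. card (reps \<kappa>))" using finT' finite_reps by simp
  finally have "real (card (diffs ` T')) \<le> real (\<Sum>\<kappa>\<in>key ` T'. card (reps \<kappa>))" by (simp only: of_nat_le_iff)
  also have "\<dots> \<le> (\<Sum>\<kappa>\<in>key ` T'. \<omega>)" unfolding of_nat_sum by (rule sum_mono) (use w in auto)
  finally show ?thesis by simp
qed

text \<open>The upper bound may be crude, since only its logarithm enters the pigeonholing.\<close>

lemma reps_card_bounds:
  assumes t: "t \<in> T"
  shows "1 \<le> card (reps (key t)) \<and> card (reps (key t)) \<le> card A ^ 4"
proof
  have "reps (key t) \<noteq> {}" using t unfolding reps_def by blast
  then show "1 \<le> card (reps (key t))" using finite_reps by (simp add: Suc_le_eq card_gt_0_iff)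
  have "reps (key t) \<subseteq> (\<lambda>(a, u, b, v). (a - u, b - v)) ` (A \<times> A \<times> A \<times> A)"
  proof
    fix p assume "p \<in> reps (key t)"
    then obtain s where s: "s \<in> T" "p = fst (diffs s)" unfolding reps_def by blast
    obtain a u b c d where s0: "s = ((a, u, b), (c, d))" by (metis surj_pair)
    then have "p = (\<lambda>(a, u, b, v). (a - u, b - v)) (a, u, b, u)" "(a, u, b, u) \<in> A \<times> A \<times> A \<times> A"
      using s T_D[of a u b c d] by auto
    then show "p \<in> (\<lambda>(a, u, b, v). (a - u, b - v)) ` (A \<times> A \<times> A \<times> A)" by (rule image_eqI)
  qed
  then have "card (reps (key t)) \<le> card (A \<times> A \<times> A \<times> A)"
    by (rule surj_card_le[rotated]) (use A in auto)
  then show "card (reps (key t)) \<le> card A ^ 4" by (simp add: card_cartesian_product power4_eq_xxxx mult.assoc)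
qed

text \<open>Pigeonholing the multiplicity to about \<open>w\<close> gives
  \<open>J \<le> 2 * w * I\<close> and \<open>w * L \<le> D ^ 3\<close>. The combination
  \<open>J\<^sup>2 * I\<close> is chosen so that \<open>w\<close> and \<open>L\<close> occur only
  through \<open>w * L\<close> and disappear.\<close>

lemma obtain_uniform_configurations:
  obtains T' :: "((real \<times> real \<times> real) \<times> (real \<times> real)) set" and I J :: real where
    "0 \<le> I" "0 \<le> J" "real (card T) \<le> card T' * (4 * H)"
    "(real (card T'))\<^sup>2 \<le> I * (2 ^ 15 * (2 ^ j) ^ 3 * n ^ 3 * H)"
    "(real (card T'))\<^sup>2 \<le> J * (real k ^ 2 * (4096 * q\<^sup>2 * n * H))"
    "J \<le> 16 * real (card (difference_set A)) ^ 3 \<or>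
     J\<^sup>2 * I \<le> 2048 * real (card dilations) ^ 4 * real (card (difference_set A)) ^ 6"
proof -
  have n4: "1 \<le> card A ^ 4" using n1 by simp
  obtain i where i: "real (card T) \<le> real (card {t \<in> T. 2 ^ i \<le> card (reps (key t)) \<and> card (reps (key t)) < 2 ^ Suc i})
      * (log 2 (card A ^ 4) + 1)"
    by (rule dyadic_pigeonhole[where v = "\<lambda>t. card (reps (key t))", OF finite_T reps_card_bounds n4])
  define T' where "T' = {t \<in> T. 2 ^ i \<le> card (reps (key t)) \<and> card (reps (key t)) < 2 ^ Suc i}"
  define I where "I = real (card (key ` T'))"
  define J where "J = real (card (diffs ` T'))"
  define L where "L = real (card (key_line ` key ` T'))"
  define w where "w = (2 :: real) ^ i"
  define D where "D = real (card (difference_set A))"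
  have w0: "0 < w" by (simp add: w_def)
  have sub: "T' \<subseteq> T" by (auto simp: T'_def)
  have lo: "w \<le> card (reps (key t))" and hi: "card (reps (key t)) \<le> 2 * w" if "t \<in> T'" for t
  proof -
    from that have "2 ^ i \<le> card (reps (key t))" "card (reps (key t)) < 2 ^ Suc i" by (auto simp: T'_def)
    then show "w \<le> card (reps (key t))" "card (reps (key t)) \<le> 2 * w"
      unfolding w_def by (metis of_nat_le_iff of_nat_numeral of_nat_power,
        metis less_imp_le of_nat_le_iff of_nat_numeral of_nat_power power_Suc)
  qed
  have "log 2 (card A ^ 4) = 4 * log 2 (card A)" using n1 by (simp add: log_nat_power)
  then have "log 2 (card A ^ 4) + 1 \<le> 4 * H" by (simp add: H_def)
  then have "real (card T') * (log 2 (card A ^ 4) + 1) \<le> card T' * (4 * H)" by (intro mult_left_mono) auto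
  then have TT: "real (card T) \<le> card T' * (4 * H)" using i by (simp add: T'_def)
  have wL: "w * L \<le> D ^ 3" unfolding L_def D_def by (rule key_lines_bound[OF sub lo])
  have J: "J \<le> I * (2 * w)" unfolding J_def I_def by (rule card_diffs_le[OF sub hi])
  have pos: "0 \<le> I" "0 \<le> J" "0 \<le> L" by (auto simp: I_def J_def L_def)
  have "I < 8 * L \<or> I ^ 3 \<le> 512 * real (card dilations) ^ 4 * L\<^sup>2"
    using key_incidences[OF sub] unfolding I_def L_def by linarith
  then have "J \<le> 16 * D ^ 3 \<or> J\<^sup>2 * I \<le> 2048 * real (card dilations) ^ 4 * D ^ 6"
  proof
    assume "I < 8 * L"
    then have "I * (2 * w) \<le> 8 * L * (2 * w)" using w0 by (intro mult_right_mono) auto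
    then have "J \<le> 16 * (w * L)" using J by (simp add: mult_ac)
    then show ?thesis using wL by linarith
  next
    assume a: "I ^ 3 \<le> 512 * real (card dilations) ^ 4 * L\<^sup>2"
    have "J\<^sup>2 * I \<le> (I * (2 * w))\<^sup>2 * I" using J pos by (intro mult_right_mono power_mono) auto
    also have "\<dots> = 4 * w\<^sup>2 * I ^ 3" by (simp add: power2_eq_square power3_eq_cube)
    also have "\<dots> \<le> 4 * w\<^sup>2 * (512 * real (card dilations) ^ 4 * L\<^sup>2)" by (intro mult_left_mono a) auto
    also have "\<dots> = 2048 * real (card dilations) ^ 4 * (w * L)\<^sup>2" by (simp add: power_mult_distrib)
    also have "\<dots> \<le> 2048 * real (card dilations) ^ 4 * (D ^ 3)\<^sup>2"
      using wL w0 pos by (intro mult_left_mono power_mono) auto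
    finally show ?thesis by (simp flip: power_mult)
  qed
  with TT pos show ?thesis
    using card_keys_ge[OF sub] card_diffs_ge[OF sub] by (intro that[of I J T']) (auto simp: I_def J_def D_def)
qed

end

subsection \<open>The lower bound\<close>

text \<open>Here \<open>s\<close>, \<open>t\<close>, \<open>t'\<close> count links, configurations
  and pigeonholed configurations, \<open>l\<close> counts dilations, and \<open>\<Delta>\<close> is
  \<open>2 ^ j\<close>. Up to \<open>H\<close> and constants, the main case gives
  \<open>n ^ 5 * k ^ 9 \<le> D ^ 6 * q ^ 4\<close>, and \<open>k \<ge> n\<^sup>2 / (4 * q)\<close>
  finishes.\<close>

lemma combine_bounds:
  fixes n q D H k \<Delta> s t t' I J l :: real
  assumes n: "1 \<le> n" and nq: "n \<le> q" and H: "1 \<le> H" and k: "1 \<le> k" "n\<^sup>2 / (4 * q) \<le> k"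
    and pos: "0 \<le> D" "1 \<le> \<Delta>" "0 \<le> s" "0 \<le> t'" "0 \<le> I" "0 \<le> J" "0 \<le> l"
    and s: "n\<^sup>2 * k / 4 \<le> s * H" "s \<le> 4 * \<Delta> * n\<^sup>2"
    and t: "s\<^sup>2 \<le> t * n" "t \<le> t' * (4 * H)"
    and I: "t'\<^sup>2 \<le> I * (2 ^ 15 * \<Delta> ^ 3 * n ^ 3 * H)"
    and J: "t'\<^sup>2 \<le> J * (k\<^sup>2 * (4096 * q\<^sup>2 * n * H))"
    and l: "l * \<Delta> \<le> n\<^sup>2"
    and D: "J \<le> 16 * D ^ 3 \<or> J\<^sup>2 * I \<le> 2048 * l ^ 4 * D ^ 6"
  shows "n ^ 23 \<le> 2 ^ 108 * H ^ 22 * D ^ 6 * q ^ 13"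
proof -
  have q: "1 \<le> q" using n nq by simp
  have kq: "n\<^sup>2 \<le> 4 * q * k" using k(2) q by (simp add: field_simps)
  have \<Delta>: "k \<le> 16 * H * \<Delta>"
  proof -
    have "n\<^sup>2 * k / 4 \<le> 4 * \<Delta> * n\<^sup>2 * H" using s H by (meson mult_right_mono order_trans zero_le_one)
    then have "n\<^sup>2 * k \<le> n\<^sup>2 * (16 * H * \<Delta>)" by (simp add: algebra_simps)
    then show ?thesis using n by (subst (asm) mult_le_cancel_left_pos) auto
  qed
  have t': "n ^ 3 * k\<^sup>2 \<le> 64 * H ^ 3 * t'"
  proof -
    have "(n\<^sup>2 * k / 4)\<^sup>2 \<le> (s * H)\<^sup>2" using n k by (intro power_mono s) auto
    also have "\<dots> = s\<^sup>2 * H\<^sup>2" by (simp add: power_mult_distrib)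
    also have "\<dots> \<le> (t' * (4 * H) * n) * H\<^sup>2"
      using t n by (intro mult_right_mono) (auto intro: order_trans mult_right_mono)
    finally have "n * (n ^ 3 * k\<^sup>2) \<le> n * (64 * H ^ 3 * t')"
      by (simp add: power2_eq_square power3_eq_cube field_simps)
    then show ?thesis using n by (subst (asm) mult_le_cancel_left_pos) auto
  qed
  show ?thesis using D
  proof
    \<comment> \<open>This case yields \<open>n ^ 9 \<le> D ^ 3 * q ^ 4\<close> up to
      \<open>H\<close> and constants; squaring and multiplying by \<open>n ^ 5 \<le> q ^ 5\<close>
      reaches the required exponents.\<close>
    assume JD: "J \<le> 16 * D ^ 3"
    define X where "X = k\<^sup>2 * (4096 * q\<^sup>2 * n * H)"
    have X: "0 \<le> X" using n q H k by (simp add: X_def)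
    have "t'\<^sup>2 \<le> 16 * D ^ 3 * X"
      by (rule order_trans[OF J[folded X_def] mult_right_mono[OF JD X]])
    then have "4096 * H ^ 6 * t'\<^sup>2 \<le> 4096 * H ^ 6 * (16 * D ^ 3 * X)"
      using H by (intro mult_left_mono) auto
    moreover have "(n ^ 3 * k\<^sup>2)\<^sup>2 \<le> (64 * H ^ 3 * t')\<^sup>2" using n by (intro power_mono t') auto
    moreover have "(64 * H ^ 3 * t')\<^sup>2 = 4096 * H ^ 6 * t'\<^sup>2" by algebra
    moreover have "(n ^ 3 * k\<^sup>2)\<^sup>2 = (n * k\<^sup>2) * (n ^ 5 * k\<^sup>2)" by algebra
    moreover have "4096 * H ^ 6 * (16 * D ^ 3 * X) = (n * k\<^sup>2) * (2 ^ 28 * H ^ 7 * D ^ 3 * q\<^sup>2)"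
      unfolding X_def by algebra
    ultimately have "(n * k\<^sup>2) * (n ^ 5 * k\<^sup>2) \<le> (n * k\<^sup>2) * (2 ^ 28 * H ^ 7 * D ^ 3 * q\<^sup>2)"
      by linarith
    then have a: "n ^ 5 * k\<^sup>2 \<le> 2 ^ 28 * H ^ 7 * D ^ 3 * q\<^sup>2"
      using n k by (subst (asm) mult_le_cancel_left_pos) auto
    have "n ^ 9 = n ^ 5 * (n\<^sup>2)\<^sup>2" by algebra
    also have "\<dots> \<le> n ^ 5 * (4 * q * k)\<^sup>2" using n by (intro mult_left_mono power_mono kq) auto
    also have "\<dots> = 16 * q\<^sup>2 * (n ^ 5 * k\<^sup>2)" by algebra
    also have "\<dots> \<le> 16 * q\<^sup>2 * (2 ^ 28 * H ^ 7 * D ^ 3 * q\<^sup>2)" by (intro mult_left_mono a) auto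
    also have "\<dots> = 2 ^ 32 * H ^ 7 * D ^ 3 * q ^ 4" by algebra
    finally have b: "n ^ 9 \<le> 2 ^ 32 * H ^ 7 * D ^ 3 * q ^ 4" .
    have "n ^ 23 = (n ^ 9)\<^sup>2 * n ^ 5" by algebra
    also have "\<dots> \<le> (2 ^ 32 * H ^ 7 * D ^ 3 * q ^ 4)\<^sup>2 * q ^ 5"
      using n nq by (intro mult_mono power_mono b) auto
    also have "\<dots> = 2 ^ 64 * H ^ 14 * D ^ 6 * q ^ 13" by algebra
    also have "\<dots> \<le> 2 ^ 108 * H ^ 22 * D ^ 6 * q ^ 13"
    proof (intro mult_right_mono)
      show "(2 :: real) ^ 64 * H ^ 14 \<le> 2 ^ 108 * H ^ 22"
        using H by (intro mult_mono power_increasing) auto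
    qed (use pos q in auto)
    finally show ?thesis .
  next
    assume JI: "J\<^sup>2 * I \<le> 2048 * l ^ 4 * D ^ 6"
    define Y where "Y = 2 ^ 39 * k ^ 4 * q ^ 4 * n ^ 5 * H ^ 3 * \<Delta> ^ 3"
    have Y: "0 \<le> Y" using n q H k pos by (simp add: Y_def)
    have "t' ^ 6 = (t'\<^sup>2)\<^sup>2 * t'\<^sup>2" by algebra
    also have "\<dots> \<le> (J * (k\<^sup>2 * (4096 * q\<^sup>2 * n * H)))\<^sup>2 * (I * (2 ^ 15 * \<Delta> ^ 3 * n ^ 3 * H))"
      using pos n H by (intro mult_mono[OF power_mono[OF J] I]) auto
    also have "\<dots> = (J\<^sup>2 * I) * Y" unfolding Y_def by algebra
    also have "\<dots> \<le> (2048 * l ^ 4 * D ^ 6) * Y" by (rule mult_right_mono[OF JI Y])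
    \<comment> \<open>The factor \<open>l ^ 4\<close> needs \<open>\<Delta> ^ 4\<close> but
      \<open>Y\<close> has only \<open>\<Delta> ^ 3\<close>. The extra \<open>\<Delta>\<close> on
      the left is worth \<open>k\<close> up to \<open>H\<close>, which is how the exponent 9 of
      \<open>k\<close> arises.\<close>
    finally have "t' ^ 6 * \<Delta> \<le> (2048 * l ^ 4 * D ^ 6) * Y * \<Delta>"
      using pos by (intro mult_right_mono) auto
    also have "\<dots> = (l * \<Delta>) ^ 4 * (2 ^ 50 * D ^ 6 * k ^ 4 * q ^ 4 * n ^ 5 * H ^ 3)"
      unfolding Y_def by algebra
    also have "\<dots> \<le> (n\<^sup>2) ^ 4 * (2 ^ 50 * D ^ 6 * k ^ 4 * q ^ 4 * n ^ 5 * H ^ 3)"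
      using l pos n q H k by (intro mult_right_mono power_mono) auto
    also have "\<dots> = 2 ^ 50 * D ^ 6 * k ^ 4 * q ^ 4 * n ^ 13 * H ^ 3" by algebra
    finally have a: "t' ^ 6 * \<Delta> \<le> 2 ^ 50 * D ^ 6 * k ^ 4 * q ^ 4 * n ^ 13 * H ^ 3" .
    have "(n ^ 13 * k ^ 4) * (n ^ 5 * k ^ 9) = (n ^ 3 * k\<^sup>2) ^ 6 * k" by algebra
    also have "\<dots> \<le> (64 * H ^ 3 * t') ^ 6 * (16 * H * \<Delta>)"
      using n k H pos by (intro mult_mono[OF power_mono[OF t'] \<Delta>]) auto
    also have "\<dots> = 2 ^ 40 * H ^ 19 * (t' ^ 6 * \<Delta>)" by algebra
    also have "\<dots> \<le> 2 ^ 40 * H ^ 19 * (2 ^ 50 * D ^ 6 * k ^ 4 * q ^ 4 * n ^ 13 * H ^ 3)"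
      using H by (intro mult_left_mono a) auto
    also have "\<dots> = (n ^ 13 * k ^ 4) * (2 ^ 90 * H ^ 22 * D ^ 6 * q ^ 4)" by algebra
    finally have b: "n ^ 5 * k ^ 9 \<le> 2 ^ 90 * H ^ 22 * D ^ 6 * q ^ 4"
      using n k by (subst (asm) mult_le_cancel_left_pos) auto
    have "n ^ 23 = n ^ 5 * (n\<^sup>2) ^ 9" by algebra
    also have "\<dots> \<le> n ^ 5 * (4 * q * k) ^ 9" using n by (intro mult_left_mono power_mono kq) auto
    also have "\<dots> = 2 ^ 18 * q ^ 9 * (n ^ 5 * k ^ 9)" by algebra
    also have "\<dots> \<le> 2 ^ 18 * q ^ 9 * (2 ^ 90 * H ^ 22 * D ^ 6 * q ^ 4)" using q by (intro mult_left_mono b) auto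
    also have "\<dots> = 2 ^ 108 * H ^ 22 * D ^ 6 * q ^ 13" by algebra
    finally show ?thesis .
  qed
qed

lemma differences_ratios_lower_bound:
  assumes A: "finite A" and A0: "0 \<notin> A" and n: "2 \<le> card A"
  shows "real (card A) ^ 23 \<le> 2 ^ 108 * (log 2 (card A) + 1) ^ 22 *
    real (card (difference_set A)) ^ 6 * real (card (ratio_set A)) ^ 13"
proof -
  obtain S0 k where S0: "finite S0" "1 \<le> k" "(real (card A))\<^sup>2 / (4 * card (ratio_set A)) \<le> k"
    "\<And>a u c. (a, u, c) \<in> S0 \<Longrightarrow> a \<noteq> u \<and> c \<in> ratio_set A \<and> a \<in> dilate_inter A c \<and> u \<in> dilate_inter A c"
    "\<And>a u. card {c. (a, u, c) \<in> S0} \<le> k"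
    "(real (card A))\<^sup>2 * k / 4 \<le> card S0"
    by (rule obtain_links[OF A A0 n], rule that)
  \<comment> \<open>The level of a link is the size of its dilate; restricting to one level costs a
    factor \<open>H\<close>.\<close>
  define v where "v s = card (dilate_inter A (snd (snd s)))" for s :: "real \<times> real \<times> real"
  have v: "1 \<le> v s \<and> v s \<le> card A" if "s \<in> S0" for s
  proof -
    obtain a u c where s: "s = (a, u, c)" by (metis prod_cases3)
    have "a \<in> dilate_inter A c" using S0(4) that s by blast
    then have "0 < card (dilate_inter A c)" using A by (auto simp: card_gt_0_iff)
    then show ?thesis using card_mono[OF A dilate_inter_subset] by (simp add: v_def s)
  qed
  have n1: "1 \<le> card A" using n by simp
  obtain j where j: "real (card S0) \<le> real (card {s \<in> S0. 2 ^ j \<le> v s \<and> v s < 2 ^ Suc j}) * (log 2 (card A) + 1)"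
    by (rule dyadic_pigeonhole[where v = v, OF S0(1) v n1])
  define S where "S = {s \<in> S0. 2 ^ j \<le> v s \<and> v s < 2 ^ Suc j}"
  interpret links A S k j
  proof
    show "card {c. (a, u, c) \<in> S} \<le> k" for a u
    proof -
      have "finite {c. (a, u, c) \<in> S0}"
        by (rule finite_subset[of _ "(\<lambda>(a, u, c). c) ` S0"]) (use S0(1) in force)+
      then have "card {c. (a, u, c) \<in> S} \<le> card {c. (a, u, c) \<in> S0}"
        by (rule card_mono) (auto simp: S_def)
      then show ?thesis using S0(5)[of a u] by linarith
    qed
  qed (use A A0 n1 S0(1,4) in \<open>auto simp: S_def v_def\<close>)
  obtain T' :: "((real \<times> real \<times> real) \<times> (real \<times> real)) set" and I J :: real where U:
    "0 \<le> I" "0 \<le> J" "real (card T) \<le> card T' * (4 * H)"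
    "(real (card T'))\<^sup>2 \<le> I * (2 ^ 15 * (2 ^ j) ^ 3 * n ^ 3 * H)"
    "(real (card T'))\<^sup>2 \<le> J * (real k ^ 2 * (4096 * q\<^sup>2 * n * H))"
    "J \<le> 16 * real (card (difference_set A)) ^ 3 \<or>
     J\<^sup>2 * I \<le> 2048 * real (card dilations) ^ 4 * real (card (difference_set A)) ^ 6"
    by (rule obtain_uniform_configurations)
  have "n ^ 23 \<le> 2 ^ 108 * H ^ 22 * real (card (difference_set A)) ^ 6 * q ^ 13"
  proof (rule combine_bounds[OF _ _ H_ge_1 _ _ _ _ _ _ U(1,2) _ _ card_links_le card_T_ge U(3-5) _ U(6)])
    show "n\<^sup>2 * real k / 4 \<le> real (card S) * H" using S0(6) j by (simp add: n_def H_def S_def)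
    show "real (card dilations) * 2 ^ j \<le> n\<^sup>2" using card_dilations_le by simp
    show "n \<le> q" using card_le_card_ratio_set[OF A A0] by (simp add: n_def q_def)
    show "n\<^sup>2 / (4 * q) \<le> real k" using S0(3) by (simp add: n_def q_def)
  qed (use n1 S0(2) in \<open>auto simp: n_def\<close>)
  then show ?thesis by (simp add: n_def q_def H_def)
qed

theorem theorem10:
  shows "(\<exists>C d :: real. C > 0 \<and> d \<ge> 0 \<and>
            (\<forall>A :: real set. finite A \<and> card A \<ge> 2 \<longrightarrow>
               real (card (difference_set A)) ^ 6 * real (card (ratio_set A)) ^ 13
                 \<ge> C * (real (card A) ^ 23 / (log 2 (real (card A))) powr d))) \<and>
         (\<forall>K :: real. K \<ge> 1 \<longrightarrow>
            (\<exists>C d :: real. C > 0 \<and> d \<ge> 0 \<and>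
              (\<forall>A :: real set. finite A \<and> card A \<ge> 2 \<and>
                   real (card (ratio_set A)) \<le> K * real (card A) \<longrightarrow>
                 real (card (difference_set A))
                   \<ge> C * real (card A) powr (5 / 3) * (log 2 (real (card A))) powr (- d))))"
proof -
  \<comment> \<open>The exponent is 23 + 108 + 22: from \<open>card A \<le> 2 * card B\<close>, from
    the bound for sets without 0, and from replacing \<open>log + 1\<close> by
    \<open>2 * log\<close>.\<close>
  define C :: real where "C = 1 / 2 ^ 153"
  have main: "C * real (card A) ^ 23 \<le> log 2 (real (card A)) ^ 22 *
      (real (card (difference_set A)) ^ 6 * real (card (ratio_set A)) ^ 13)"
    if A: "finite A" and N: "2 \<le> card A" for A :: "real set"
  \<comment> \<open>Deleting 0 from a two-element set may leave a single element. In this case the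
    logarithm is 1 and \<open>C * 2 ^ 23 \<le> 1\<close>, so it is enough that both sets are
    nonempty.\<close>
  proof (cases "card A = 2")
    case True
    have "\<not> A \<subseteq> {0}" using card_mono[of "{0}" A] N by auto
    then obtain a where a: "a \<in> A" "a \<noteq> 0" by blast
    have "a - a \<in> difference_set A" using a unfolding difference_set_def by blast
    then have D: "1 \<le> real (card (difference_set A))"
      using finite_difference_set[OF A] by (auto simp: Suc_le_eq card_gt_0_iff)
    have "a / a \<in> ratio_set A" using a unfolding ratio_set_def by blast
    then have Q: "1 \<le> real (card (ratio_set A))"
      using finite_ratio_set[OF A] by (auto simp: Suc_le_eq card_gt_0_iff)
    have "C * real (card A) ^ 23 \<le> 1" using True by (simp add: C_def)
    also have "1 \<le> real (card (difference_set A)) ^ 6 * real (card (ratio_set A)) ^ 13"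
      using mult_mono[OF one_le_power[OF D, of 6] one_le_power[OF Q, of 13]] by simp
    finally show ?thesis using True by simp
  next
    case False
    define B where "B = A - {0}"
    define N' where "N' = real (card A)"
    have B: "finite B" "0 \<notin> B" "card A \<le> card B + 1" "card B \<le> card A"
      using A by (auto simp: B_def card_Diff_singleton_if intro: card_mono)
    have B2: "2 \<le> card B" using False N B(3) by linarith
    have "card A \<le> 2 * card B" using B(3) B2 by linarith
    then have NB: "N' \<le> 2 * real (card B)" unfolding N'_def by linarith
    have D: "real (card (difference_set B)) \<le> real (card (difference_set A))"
      by (intro of_nat_mono card_mono finite_difference_set A) (auto simp: difference_set_def B_def)
    have Q: "real (card (ratio_set B)) \<le> real (card (ratio_set A))"
      by (intro of_nat_mono card_mono finite_ratio_set A) (auto simp: ratio_set_def B_def)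
    have "log 2 (card B) \<le> log 2 N'" using B(4) B2 by (simp add: N'_def)
    moreover have "log 2 2 \<le> log 2 N'" using N by (subst log_le_cancel_iff) (auto simp: N'_def)
    ultimately have H: "log 2 (card B) + 1 \<le> 2 * log 2 N'" by simp
    have H0: "0 \<le> log 2 (card B) + 1" using B2 by (simp add: add_nonneg_nonneg)
    have "N' ^ 23 \<le> (2 * real (card B)) ^ 23" using NB by (intro power_mono) (auto simp: N'_def)
    also have "\<dots> = 2 ^ 23 * real (card B) ^ 23" by (simp add: power_mult_distrib)
    also have "\<dots> \<le> 2 ^ 23 * (2 ^ 108 * (log 2 (card B) + 1) ^ 22 *
        real (card (difference_set B)) ^ 6 * real (card (ratio_set B)) ^ 13)"
      by (intro mult_left_mono differences_ratios_lower_bound B B2) auto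
    also have "\<dots> \<le> 2 ^ 23 * (2 ^ 108 * (2 * log 2 N') ^ 22 *
        real (card (difference_set A)) ^ 6 * real (card (ratio_set A)) ^ 13)"
      using H0 H by (intro mult_left_mono mult_mono power_mono D Q H) auto
    also have "\<dots> = 2 ^ 153 * (log 2 N' ^ 22 * (real (card (difference_set A)) ^ 6 * real (card (ratio_set A)) ^ 13))"
      by (simp add: power_mult_distrib)
    finally show ?thesis by (simp add: C_def N'_def field_simps)
  qed
  have root6: "(x ^ m) powr (1 / 6) = x powr (real m / 6)" if "0 < x" for x :: real and m
    using that by (simp add: powr_powr flip: powr_realpow)
  have C0: "0 < C" by (simp add: C_def)
  have L1: "1 \<le> log 2 (real (card A))" if "2 \<le> card A" for A :: "real set"
    using that by simp
  have first: "C * (real (card A) ^ 23 / log 2 (real (card A)) powr 22)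
      \<le> real (card (difference_set A)) ^ 6 * real (card (ratio_set A)) ^ 13"
    if "finite A" "2 \<le> card A" for A :: "real set"
  proof -
    have "log 2 (real (card A)) powr 22 = log 2 (real (card A)) ^ 22"
      using L1[OF that(2)] by (subst powr_realpow[symmetric]) auto
    then show ?thesis using main[OF that] L1[OF that(2)] by (simp add: field_simps)
  qed
  have second: "\<exists>C' d. C' > 0 \<and> d \<ge> 0 \<and>
      (\<forall>A :: real set. finite A \<and> card A \<ge> 2 \<and> real (card (ratio_set A)) \<le> K * real (card A) \<longrightarrow>
        real (card (difference_set A)) \<ge> C' * real (card A) powr (5 / 3) * (log 2 (real (card A))) powr (- d))"
    if K: "1 \<le> K" for K
  proof (intro exI conjI allI impI)
    \<comment> \<open>Constants from the sixth root of \<open>main\<close> after inserting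
      \<open>card (ratio_set A) \<le> K * card A\<close>: the exponents become
      \<open>(23 - 13) / 6 = 5 / 3\<close> and \<open>22 / 6\<close>.\<close>
    show "0 < (C / K ^ 13) powr (1 / 6)" using C0 K by simp
    show "0 \<le> (22 / 6 :: real)" by simp
    fix A :: "real set" assume A: "finite A \<and> card A \<ge> 2 \<and> real (card (ratio_set A)) \<le> K * real (card A)"
    define N where "N = real (card A)"
    define L where "L = log 2 N"
    define D where "D = real (card (difference_set A))"
    have N: "2 \<le> N" using A by (simp add: N_def)
    have L: "1 \<le> L" using L1[of A] A by (simp add: L_def N_def)
    have "C * N ^ 23 \<le> L ^ 22 * (D ^ 6 * real (card (ratio_set A)) ^ 13)"
      using main[of A] A by (simp add: N_def L_def D_def)
    also have "\<dots> \<le> L ^ 22 * (D ^ 6 * (K * N) ^ 13)"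
      using A L by (intro mult_left_mono power_mono) (auto simp: N_def)
    finally have "N ^ 13 * (C * N ^ 10) \<le> N ^ 13 * (K ^ 13 * L ^ 22 * D ^ 6)"
      by (simp add: power_mult_distrib mult_ac flip: power_add)
    then have "C * N ^ 10 \<le> K ^ 13 * L ^ 22 * D ^ 6" using N by (subst (asm) mult_le_cancel_left_pos) auto
    then have *: "C / K ^ 13 * N ^ 10 / L ^ 22 \<le> D ^ 6" using K L by (simp add: field_simps)
    have "(C / K ^ 13) powr (1 / 6) * N powr (5 / 3) * L powr (- (22 / 6)) = (C / K ^ 13 * N ^ 10 / L ^ 22) powr (1 / 6)"
      using N L C0 K root6[of N 10] root6[of L 22]
      by (simp add: powr_mult powr_divide powr_minus_divide)
    also have "\<dots> \<le> (D ^ 6) powr (1 / 6)" using * C0 K N L by (intro powr_mono2) auto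
    also have "\<dots> = D" using root6[of D 6] by (cases "D = 0") (auto simp: D_def)
    finally show "real (card (difference_set A)) \<ge> (C / K ^ 13) powr (1 / 6) * real (card A) powr (5 / 3)
        * (log 2 (real (card A))) powr (- (22 / 6))"
      by (simp add: N_def L_def D_def)
  qed
  show ?thesis
    using C0 first second by (intro conjI exI[of _ C] exI[of _ 22]) auto
qed

end
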